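(* There is a computable diminutive measure on $2^\omega$ that is not trivial.
   Context: All measures are Borel probability measures on Cantor space $2^\omega$. A measure $\mu$ is computable if $\sigma\mapsto\mu(\{X:\sigma\prec X\})$ is a computable real-valued function on finite binary strings. $\mathrm{Atoms}_\mu=\{X:\mu(\{X\})>0\}$; $\mu$ is trivial if $\mu(\mathrm{Atoms}_\mu)=1$. For $\mathcal C\subseteq 2^\omega$ let $\mathrm{Ext}(\mathcal C)=\{\sigma\in 2^{<\omega}:(\exists X\in\mathcal C)\,\sigma\prec X\}$. A nonempty class $\mathcal C\subseteq 2^\omega$ is computably perfect if there is a computable, strictly increasing $f:\omega\to\omega$ such that for each $n$ and each $\sigma\in\mathrm{Ext}(\mathcal C)$ with $|\sigma|=f(n)$ there are incomparable $\tau_1,\tau_2\in\mathrm{Ext}(\mathcal C)$ extending $\sigma$ with $|\tau_1|=|\tau_2|=f(n+1)$. A class $\mathcal C$ is diminutive if it does not contain a computably perfect subclass. A $\mu$-Martin-Löf test is a uniformly $\Sigma^0_1$ sequence $(\mathcal U_i)_{i\in\omega}$ with $\mu(\mathcal U_i)\le 2^{-i}$; it is universal if $\bigcap_i\mathcal U_i$ contains $\bigcap_i\mathcal V_i$ for every $\mu$-Martin-Löf test $(\mathcal V_i)_i$. A computable measure $\mu$ is diminutive if, for a universal $\mu$-Martin-Löf test $(\mathcal U_i)_{i\in\omega}$, the $\Pi^0_1$ class $2^\omega\setminus\mathcal U_i$ is diminutive for every $i$. *)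

theory Defs
  imports
    "HOL-Probability.Probability"
    "HOL-Library.Nat_Bijection"
    "HOL-Library.Countable"
    "HOL-Library.Sublist"
begin

(* The mu-recursive partial functions, in unary form: arguments are packed with prod_encode. *)
inductive partrec :: "(nat \<Rightarrow> nat option) \<Rightarrow> bool" where
  zero: "partrec (\<lambda>n. Some 0)"
| succ: "partrec (\<lambda>n. Some (Suc n))"
| left: "partrec (\<lambda>n. Some (fst (prod_decode n)))"
| right: "partrec (\<lambda>n. Some (snd (prod_decode n)))"
| pair: "partrec f \<Longrightarrow> partrec g \<Longrightarrow>
    partrec (\<lambda>n. Option.bind (f n) (\<lambda>a. Option.bind (g n) (\<lambda>b. Some (prod_encode (a, b)))))"
| comp: "partrec f \<Longrightarrow> partrec g \<Longrightarrow> partrec (\<lambda>n. Option.bind (g n) f)"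
| prec: "partrec f \<Longrightarrow> partrec g \<Longrightarrow>
    partrec (\<lambda>n. case prod_decode n of (a, m) \<Rightarrow>
      rec_nat (f a)
        (\<lambda>k r. Option.bind r (\<lambda>y. g (prod_encode (a, prod_encode (k, y))))) m)"
  (* unbounded search: diverges if some value before the first zero is undefined *)
| search: "partrec f \<Longrightarrow>
    partrec (\<lambda>a.
      if \<exists>n. f (prod_encode (a, n)) = Some 0 \<and> (\<forall>m<n. f (prod_encode (a, m)) \<noteq> None)
      then Some (LEAST n. f (prod_encode (a, n)) = Some 0)
      else None)"

definition computable :: "(nat \<Rightarrow> nat) \<Rightarrow> bool" where
  "computable f \<longleftrightarrow> partrec (\<lambda>n. Some (f n))"

definition comp_enumerable :: "nat set \<Rightarrow> bool" where
  "comp_enumerable A \<longleftrightarrow> (\<exists>f. partrec f \<and> A = dom f)"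

type_synonym cantor = "nat \<Rightarrow> bool"

definition str_code :: "bool list \<Rightarrow> nat" where
  "str_code \<sigma> = list_encode (map of_bool \<sigma>)"

definition init_seg :: "bool list \<Rightarrow> cantor \<Rightarrow> bool" where
  "init_seg \<sigma> X \<longleftrightarrow> (\<forall>i<length \<sigma>. \<sigma> ! i = X i)"

definition cylinder :: "bool list \<Rightarrow> cantor set" where
  "cylinder \<sigma> = {X. init_seg \<sigma> X}"

(* A real-valued function on strings is computable if its values can be uniformly
   approximated by rationals to within any given precision. *)
definition computable_real_on_strings :: "(bool list \<Rightarrow> real) \<Rightarrow> bool" where
  "computable_real_on_strings r \<longleftrightarrow>
    (\<exists>g. computable g \<and>
      (\<forall>\<sigma> n. \<bar>r \<sigma> - of_rat (nat_to_rat_surj (g (prod_encode (str_code \<sigma>, n))))\<bar> \<le> (1/2) ^ n))"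

(* borel refers to the product topology on nat => bool, with bool discrete. *)
definition cantor_measure :: "cantor measure \<Rightarrow> bool" where
  "cantor_measure \<mu> \<longleftrightarrow> prob_space \<mu> \<and> sets \<mu> = sets borel"

definition computable_measure :: "cantor measure \<Rightarrow> bool" where
  "computable_measure \<mu> \<longleftrightarrow>
    cantor_measure \<mu> \<and> computable_real_on_strings (\<lambda>\<sigma>. measure \<mu> (cylinder \<sigma>))"

definition atoms :: "cantor measure \<Rightarrow> cantor set" where
  "atoms \<mu> = {X. measure \<mu> {X} > 0}"

definition trivial_measure :: "cantor measure \<Rightarrow> bool" where
  "trivial_measure \<mu> \<longleftrightarrow> measure \<mu> (atoms \<mu>) = 1"

definition Ext :: "cantor set \<Rightarrow> bool list set" where
  "Ext C = {\<sigma>. \<exists>X\<in>C. init_seg \<sigma> X}"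

definition computably_perfect :: "cantor set \<Rightarrow> bool" where
  "computably_perfect C \<longleftrightarrow> C \<noteq> {} \<and>
    (\<exists>f. computable f \<and> strict_mono f \<and>
      (\<forall>n. \<forall>\<sigma>\<in>Ext C. length \<sigma> = f n \<longrightarrow>
        (\<exists>\<tau>1\<in>Ext C. \<exists>\<tau>2\<in>Ext C. \<tau>1 \<parallel> \<tau>2 \<and> prefix \<sigma> \<tau>1 \<and> prefix \<sigma> \<tau>2 \<and>
          length \<tau>1 = f (Suc n) \<and> length \<tau>2 = f (Suc n))))"

definition diminutive_class :: "cantor set \<Rightarrow> bool" where
  "diminutive_class C \<longleftrightarrow> \<not> (\<exists>D\<subseteq>C. computably_perfect D)"

definition uniformly_Sigma01 :: "(nat \<Rightarrow> cantor set) \<Rightarrow> bool" where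
  "uniformly_Sigma01 U \<longleftrightarrow>
    (\<exists>W. comp_enumerable W \<and>
      (\<forall>i. U i = (\<Union>\<sigma>\<in>{\<sigma>. prod_encode (i, str_code \<sigma>) \<in> W}. cylinder \<sigma>)))"

definition MartinLof_test :: "cantor measure \<Rightarrow> (nat \<Rightarrow> cantor set) \<Rightarrow> bool" where
  "MartinLof_test \<mu> U \<longleftrightarrow> uniformly_Sigma01 U \<and> (\<forall>i. measure \<mu> (U i) \<le> (1/2) ^ i)"

definition universal_MartinLof_test :: "cantor measure \<Rightarrow> (nat \<Rightarrow> cantor set) \<Rightarrow> bool" where
  "universal_MartinLof_test \<mu> U \<longleftrightarrow>
    MartinLof_test \<mu> U \<and> (\<forall>V. MartinLof_test \<mu> V \<longrightarrow> (\<Inter>i. V i) \<subseteq> (\<Inter>i. U i))"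

definition diminutive_measure :: "cantor measure \<Rightarrow> bool" where
  "diminutive_measure \<mu> \<longleftrightarrow> computable_measure \<mu> \<and>
    (\<exists>U. universal_MartinLof_test \<mu> U \<and> (\<forall>i. diminutive_class (- U i)))"

end

theory Submission
  imports Defs
begin

text \<open>
  The measure is made so that its random sequences, unless they are atoms, contain forced runs of
  zeros longer than any computable function predicts. Bits are fair coin flips, organised in
  blocks. A block first chooses an index \<open>e\<close>, with probability \<open>2\<^sup>-\<^sup>(\<^sup>e\<^sup>+\<^sup>1\<^sup>)\<close>. If a value of
  the \<open>e\<close>-th candidate function has been computed since the last opportunity, the sequence then
  continues with zeros until further values have been computed.

  If the \<open>e\<close>-th function \<open>f\<close> is total, there are infinitely many such opportunities, each taken
  with a fixed probability, so a random sequence with infinitely many blocks waits for \<open>e\<close> at some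
  point; there it is the only sequence of positive mass between some lengths \<open>f n\<close> and
  \<open>f (n + 1)\<close>, and no class perfect via \<open>f\<close> contains it. If the \<open>e\<close>-th function is partial, only
  the last two opportunities can lead to waiting forever, that is, to an atom. This costs mass at
  most \<open>2\<^sup>-\<^sup>e\<close>, which sums up to at most 1/2 because the indices 0 and 1 are not used.
\<close>

section \<open>Computable functions between encodable types\<close>

text \<open>Totality is undecidable, so a measure that waits for values of total functions must risk
  waiting for values that never come. Asking for a fresh advance before each wait rations this risk:
  if clock \<open>e\<close> stops at K, a wait can last forever only in a block that starts at clock
  value K - 1 or K, and a sequence meets at most one eligible block per value. This gives 2 *
  2^-(e+1) = 2^-e.

  A wait lasts for two advances because the first only fixes a base \<open>t\<close> after the start
  of the wait; the second then witnesses that \<open>f (t + e + 2)\<close> has appeared. So the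
  whole interval from \<open>f (t + e + 1)\<close> to \<open>f (t + e + 2)\<close> lies within the
  wait.

  Every decision depends on the prefix read so far and on finitely many steps of computation, so the
  masses of cylinders are exact dyadic rationals. Both estimates, for the mass of the atoms and for
  the probability of never choosing \<open>e\<close>, come from supermartingales on strings.\<close>

lemma computable_const: "computable (\<lambda>_. k)"
proof (induction k)
  case 0
  show ?case unfolding computable_def by (rule partrec.zero)
next
  case (Suc k)
  then show ?case
    using partrec.comp[OF partrec.succ, of "\<lambda>_. Some k"] by (simp add: computable_def)
qed

lemma computable_Suc: "computable Suc"
  unfolding computable_def by (rule partrec.succ)

lemma computable_fst: "computable (\<lambda>n. fst (prod_decode n))"
  unfolding computable_def by (rule partrec.left)

lemma computable_snd: "computable (\<lambda>n. snd (prod_decode n))"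
  unfolding computable_def by (rule partrec.right)

lemma computable_pair:
  "computable f \<Longrightarrow> computable g \<Longrightarrow> computable (\<lambda>n. prod_encode (f n, g n))"
  using partrec.pair[of "\<lambda>n. Some (f n)" "\<lambda>n. Some (g n)"] by (simp add: computable_def)

lemma computable_comp:
  "computable f \<Longrightarrow> computable g \<Longrightarrow> computable (\<lambda>n. f (g n))"
  using partrec.comp[of "\<lambda>n. Some (f n)" "\<lambda>n. Some (g n)"] by (simp add: computable_def)

lemma computable_id: "computable (\<lambda>n. n)"
  using computable_pair[OF computable_fst computable_snd] by simp

lemma computable_prec:
  assumes "computable f" "computable g" "computable u" "computable v"
  shows "computable (\<lambda>n. rec_nat (f (u n)) (\<lambda>k r. g (prod_encode (u n, prod_encode (k, r)))) (v n))"
proof -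
  have *: "rec_nat (Some a) (\<lambda>k r. Option.bind r (\<lambda>y. Some (h k y))) m = Some (rec_nat a h m)"
    for a m and h :: "nat \<Rightarrow> nat \<Rightarrow> nat"
    by (induction m) auto
  have "computable (\<lambda>n. case prod_decode n of (a, m) \<Rightarrow>
      rec_nat (f a) (\<lambda>k r. g (prod_encode (a, prod_encode (k, r)))) m)"
    using partrec.prec[of "\<lambda>n. Some (f n)" "\<lambda>n. Some (g n)"] assms(1,2)
    by (simp add: computable_def * case_prod_unfold)
  from computable_comp[OF this computable_pair[OF assms(3,4)]] show ?thesis by simp
qed

text \<open>A case distinction is a primitive recursion on the condition whose step ignores the
  accumulator: no round leaves \<open>f n\<close>, any positive number of rounds gives
  \<open>g n\<close>.\<close>

lemma computable_if_zero:
  assumes "computable c" "computable f" "computable g"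
  shows "computable (\<lambda>n. if c n = 0 then f n else g n)"
proof -
  have "computable (\<lambda>n. rec_nat (f n) (\<lambda>k r. g (fst (prod_decode (prod_encode (n, prod_encode (k, r)))))) (c n))"
    using computable_prec[OF assms(2) computable_comp[OF assms(3) computable_fst] computable_id assms(1)] .
  moreover have "rec_nat (f n) (\<lambda>k r. g n) (c n) = (if c n = 0 then f n else g n)" for n
    by (cases "c n") auto
  ultimately show ?thesis by simp
qed

lemma computable_pred: "computable (\<lambda>n. n - 1)"
proof -
  have "computable (\<lambda>n. rec_nat 0 (\<lambda>k r. fst (prod_decode (snd (prod_decode (prod_encode (n, prod_encode (k, r))))))) n)"
    using computable_prec[OF computable_const[of 0] computable_comp[OF computable_fst computable_snd]
        computable_id computable_id] .
  moreover have "rec_nat 0 (\<lambda>k r. k) n = n - 1" for n by (cases n) auto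
  ultimately show ?thesis by simp
qed

text \<open>Makes tuples, strings and lists of strings arguments of \<open>partrec\<close>
  functions. Pairs and lists are coded as in \<open>partrec\<close> and \<open>str_code\<close>, so
  the constructors are realized directly.\<close>

class encodable =
  fixes enc :: "'a \<Rightarrow> nat"
  assumes inj_enc: "inj enc"

instantiation nat :: encodable
begin
definition enc_nat :: "nat \<Rightarrow> nat" where "enc_nat n = n"
instance by standard (simp add: enc_nat_def inj_def)
end

instantiation bool :: encodable
begin
definition enc_bool :: "bool \<Rightarrow> nat" where "enc_bool b = of_bool b"
instance by standard (auto simp: enc_bool_def inj_def of_bool_def split: if_splits)
end

instantiation prod :: (encodable, encodable) encodable
begin
definition enc_prod :: "'a \<times> 'b \<Rightarrow> nat" where
  "enc_prod z = prod_encode (enc (fst z), enc (snd z))"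
instance by standard (auto simp: enc_prod_def inj_def dest: injD[OF inj_enc])
end

instantiation list :: (encodable) encodable
begin
definition enc_list :: "'a list \<Rightarrow> nat" where "enc_list xs = list_encode (map enc xs)"
instance
  by standard (auto simp: enc_list_def inj_def list_encode_eq inj_map_eq_map[OF inj_enc])
end

lemma str_code_eq_enc: "str_code = enc"
  by (rule ext) (simp add: str_code_def enc_list_def enc_bool_def[abs_def])

lemma enc_eq_iff [simp]: "enc x = enc y \<longleftrightarrow> x = y"
  by (meson injD inj_enc)

text \<open>A realizer acts on codes; its values at numbers that are not codes are
  unconstrained.\<close>

definition recursive :: "('a::encodable \<Rightarrow> 'b::encodable) \<Rightarrow> bool" where
  "recursive f \<longleftrightarrow> (\<exists>g. computable g \<and> (\<forall>x. g (enc x) = enc (f x)))"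

lemma recursiveI: "computable g \<Longrightarrow> (\<And>x. g (enc x) = enc (f x)) \<Longrightarrow> recursive f"
  unfolding recursive_def by blast

lemma recursiveE:
  assumes "recursive f"
  obtains g where "computable g" "\<And>x. g (enc x) = enc (f x)"
  using assms unfolding recursive_def by blast

lemma recursive_nat_iff: "recursive f \<longleftrightarrow> computable (f :: nat \<Rightarrow> nat)"
proof -
  have "g = f" if "\<forall>x. g x = f x" for g using that by auto
  then show ?thesis unfolding recursive_def enc_nat_def by blast
qed

section \<open>Closure properties, stated for composed arguments so that terms can be taken apart by
  introduction rules\<close>

named_theorems recursive_intros

lemma recursive_const [recursive_intros]: "recursive (\<lambda>_. k)"
  by (rule recursiveI[OF computable_const]) simp

lemma recursive_id [recursive_intros]: "recursive (\<lambda>x. x)"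
  by (rule recursiveI[OF computable_id]) simp

lemma recursive_comp:
  assumes "recursive f" "recursive g"
  shows "recursive (\<lambda>x. f (g x))"
proof -
  obtain f' g' where "computable f'" "\<And>x. f' (enc x) = enc (f x)"
    "computable g'" "\<And>x. g' (enc x) = enc (g x)"
    using assms by (elim recursiveE) (rule that)
  then show ?thesis by (intro recursiveI[OF computable_comp[of f' g']]) auto
qed

lemma recursive_Pair [recursive_intros]:
  assumes "recursive f" "recursive g"
  shows "recursive (\<lambda>x. (f x, g x))"
proof -
  obtain f' g' where "computable f'" "\<And>x. f' (enc x) = enc (f x)"
    "computable g'" "\<And>x. g' (enc x) = enc (g x)"
    using assms by (elim recursiveE) (rule that)
  then show ?thesis by (intro recursiveI[OF computable_pair[of f' g']]) (auto simp: enc_prod_def)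
qed

text \<open>Carries a fact about \<open>h\<close> on pairs, the form in which definitions are shown
  recursive, to a curried occurrence with recursive arguments.\<close>

lemma recursive_comp2:
  assumes "recursive (\<lambda>z. h (fst z) (snd z))" "recursive f" "recursive g"
  shows "recursive (\<lambda>x. h (f x) (g x))"
  using recursive_comp[OF assms(1) recursive_Pair[OF assms(2,3)]] by simp

lemma recursive_comp3:
  assumes "recursive (\<lambda>z. h (fst z) (fst (snd z)) (snd (snd z)))"
    "recursive f" "recursive g" "recursive k"
  shows "recursive (\<lambda>x. h (f x) (g x) (k x))"
  using recursive_comp[OF assms(1) recursive_Pair[OF assms(2) recursive_Pair[OF assms(3,4)]]] by simp

lemma recursive_comp4:
  assumes "recursive (\<lambda>z. h (fst z) (fst (snd z)) (fst (snd (snd z))) (snd (snd (snd z))))"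
    "recursive f" "recursive g" "recursive k" "recursive l"
  shows "recursive (\<lambda>x. h (f x) (g x) (k x) (l x))"
  using recursive_comp[OF assms(1) recursive_Pair[OF assms(2) recursive_Pair[OF assms(3)
    recursive_Pair[OF assms(4,5)]]]] by simp

lemma recursive_fst [recursive_intros]:
  assumes "recursive f" shows "recursive (\<lambda>x. fst (f x))"
proof -
  have "recursive (fst :: 'b \<times> 'c \<Rightarrow> 'b)"
    by (rule recursiveI[OF computable_fst]) (simp add: enc_prod_def)
  from recursive_comp[OF this assms] show ?thesis .
qed

lemma recursive_snd [recursive_intros]:
  assumes "recursive f" shows "recursive (\<lambda>x. snd (f x))"
proof -
  have "recursive (snd :: 'b \<times> 'c \<Rightarrow> 'c)"
    by (rule recursiveI[OF computable_snd]) (simp add: enc_prod_def)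
  from recursive_comp[OF this assms] show ?thesis .
qed

lemma recursive_enc [recursive_intros]:
  assumes "recursive f" shows "recursive (\<lambda>x. enc (f x))"
  using assms unfolding recursive_def by (simp add: enc_nat_def)

lemma recursive_prod_decode [recursive_intros]:
  assumes "recursive f" shows "recursive (\<lambda>x. prod_decode (f x))"
proof -
  have "recursive prod_decode"
    by (rule recursiveI[OF computable_id]) (simp add: enc_prod_def enc_nat_def)
  from recursive_comp[OF this assms] show ?thesis .
qed

lemma recursive_prod_encode [recursive_intros]:
  assumes "recursive f" shows "recursive (\<lambda>x. prod_encode (f x))"
proof -
  have "recursive prod_encode"
    by (rule recursiveI[OF computable_id]) (simp add: enc_prod_def enc_nat_def)
  from recursive_comp[OF this assms] show ?thesis .
qed

text \<open>The code of \<open>(x, k, r)\<close> is exactly the argument that the step function in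
  \<open>partrec.prec\<close> receives, so a realizer of \<open>s\<close> serves there as it
  stands.\<close>

lemma recursive_rec_nat [recursive_intros]:
  fixes n :: "'a::encodable \<Rightarrow> nat" and b :: "'a \<Rightarrow> 'b::encodable"
  assumes "recursive b" "recursive (\<lambda>z. s (fst z) (fst (snd z)) (snd (snd z)))" "recursive n"
  shows "recursive (\<lambda>x. rec_nat (b x) (s x) (n x))"
proof -
  obtain b' s' n' where
    b': "computable b'" "\<And>x. b' (enc x) = enc (b x)" and
    s': "computable s'" "\<And>z. s' (enc z) = enc (s (fst z) (fst (snd z)) (snd (snd z)))" and
    n': "computable n'" "\<And>x. n' (enc x) = enc (n x)"
    using assms by (elim recursiveE) (rule that)
  have s'': "s' (prod_encode (enc x, prod_encode (k, enc r))) = enc (s x k r)" for x k r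
    using s'(2)[of "(x, k, r)"] by (simp add: enc_prod_def enc_nat_def)
  have "rec_nat (b' (enc x)) (\<lambda>k r. s' (prod_encode (enc x, prod_encode (k, r)))) m
      = enc (rec_nat (b x) (s x) m)" for x m
    by (induction m) (auto simp: b'(2) s'')
  then show ?thesis
    by (intro recursiveI[OF computable_prec[OF b'(1) s'(1) computable_id n'(1)]])
      (simp add: n'(2) enc_nat_def)
qed

lemma recursive_If [recursive_intros]:
  assumes "recursive c" "recursive f" "recursive g"
  shows "recursive (\<lambda>x. if c x then f x else g x)"
proof -
  obtain c' f' g' where
    c': "computable c'" "\<And>x. c' (enc x) = enc (c x)" and
    f': "computable f'" "\<And>x. f' (enc x) = enc (f x)" and
    g': "computable g'" "\<And>x. g' (enc x) = enc (g x)"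
    using assms by (elim recursiveE) (rule that)
  show ?thesis
    by (rule recursiveI[OF computable_if_zero[OF c'(1) g'(1) f'(1)]])
      (simp add: c' f' g' enc_bool_def)
qed

lemma recursive_Suc [recursive_intros]:
  assumes "recursive f" shows "recursive (\<lambda>x. Suc (f x))"
proof -
  have "recursive Suc" by (simp add: recursive_nat_iff computable_Suc)
  from recursive_comp[OF this assms] show ?thesis .
qed

lemma recursive_add [recursive_intros]:
  fixes f g :: "_ \<Rightarrow> nat"
  assumes "recursive f" "recursive g" shows "recursive (\<lambda>x. f x + g x)"
proof -
  have *: "rec_nat m (\<lambda>k r. Suc r) n = m + n" for m n by (induction n) auto
  have "recursive (\<lambda>x. rec_nat (f x) (\<lambda>k r. Suc r) (g x))"
    by (intro recursive_intros assms)
  then show ?thesis unfolding * .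
qed

lemma recursive_diff [recursive_intros]:
  fixes f g :: "_ \<Rightarrow> nat"
  assumes "recursive f" "recursive g" shows "recursive (\<lambda>x. f x - g x)"
proof -
  have *: "rec_nat m (\<lambda>k r. r - 1) n = m - n" for m n :: nat by (induction n) auto
  have "recursive (\<lambda>n::nat. n - 1)"
    unfolding recursive_nat_iff by (rule computable_pred)
  then have "recursive (\<lambda>x. rec_nat (f x) (\<lambda>k r. r - 1) (g x))"
    by (intro recursive_rec_nat assms recursive_comp[OF \<open>recursive (\<lambda>n::nat. n - 1)\<close>] recursive_snd recursive_id)
  then show ?thesis unfolding * .
qed

lemma recursive_mult [recursive_intros]:
  fixes f g :: "_ \<Rightarrow> nat"
  assumes "recursive f" "recursive g" shows "recursive (\<lambda>x. f x * g x)"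
proof -
  have *: "rec_nat 0 (\<lambda>k r. m + r) n = m * n" for m n :: nat by (induction n) auto
  have "recursive (\<lambda>x. rec_nat 0 (\<lambda>k r. f x + r) (g x))"
    by (intro recursive_intros assms recursive_comp[OF assms(1)])
  then show ?thesis unfolding * .
qed

lemma recursive_power [recursive_intros]:
  fixes f g :: "_ \<Rightarrow> nat"
  assumes "recursive f" "recursive g" shows "recursive (\<lambda>x. f x ^ g x)"
proof -
  have *: "rec_nat 1 (\<lambda>k r. m * r) n = m ^ n" for m n :: nat by (induction n) auto
  have "recursive (\<lambda>x. rec_nat 1 (\<lambda>k r. f x * r) (g x))"
    by (intro recursive_intros assms recursive_comp[OF assms(1)])
  then show ?thesis unfolding * .
qed

lemma recursive_not [recursive_intros]:
  assumes "recursive f" shows "recursive (\<lambda>x. \<not> f x)"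
proof -
  have "(\<lambda>x. \<not> f x) = (\<lambda>x. if f x then False else True)" by auto
  then show ?thesis
    using recursive_If[OF assms recursive_const[of False] recursive_const[of True]] by simp
qed

lemma recursive_conj [recursive_intros]:
  assumes "recursive f" "recursive g" shows "recursive (\<lambda>x. f x \<and> g x)"
proof -
  have "(\<lambda>x. f x \<and> g x) = (\<lambda>x. if f x then g x else False)" by auto
  then show ?thesis using recursive_If[OF assms recursive_const[of False]] by simp
qed

lemma recursive_disj [recursive_intros]:
  assumes "recursive f" "recursive g" shows "recursive (\<lambda>x. f x \<or> g x)"
proof -
  have "(\<lambda>x. f x \<or> g x) = (\<lambda>x. if f x then True else g x)" by auto
  then show ?thesis using recursive_If[OF assms(1) recursive_const[of True] assms(2)] by simp
qed

lemma recursive_imp [recursive_intros]: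
  assumes "recursive f" "recursive g" shows "recursive (\<lambda>x. f x \<longrightarrow> g x)"
  using recursive_disj[OF recursive_not[OF assms(1)] assms(2)] unfolding imp_conv_disj .

lemma recursive_eq_zero:
  assumes "recursive f" shows "recursive (\<lambda>x. f x = (0::nat))"
proof -
  have *: "rec_nat True (\<lambda>_ _. False) n \<longleftrightarrow> n = 0" for n by (cases n) auto
  have "recursive (\<lambda>x. rec_nat True (\<lambda>_ _. False) (f x))"
    by (intro recursive_intros assms)
  then show ?thesis unfolding * .
qed

lemma recursive_le [recursive_intros]:
  fixes f g :: "_ \<Rightarrow> nat"
  assumes "recursive f" "recursive g" shows "recursive (\<lambda>x. f x \<le> g x)"
  using recursive_eq_zero[OF recursive_diff[OF assms]] by simp

lemma recursive_less [recursive_intros]: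
  fixes f g :: "_ \<Rightarrow> nat"
  assumes "recursive f" "recursive g" shows "recursive (\<lambda>x. f x < g x)"
  using recursive_not[OF recursive_le[OF assms(2,1)]] by (simp add: not_le)

lemma recursive_eq [recursive_intros]:
  fixes f g :: "_ \<Rightarrow> 'b::encodable"
  assumes "recursive f" "recursive g" shows "recursive (\<lambda>x. f x = g x)"
proof -
  have "recursive (\<lambda>x. enc (f x) \<le> enc (g x) \<and> enc (g x) \<le> enc (f x))"
    by (intro recursive_intros assms)
  then show ?thesis by (simp add: eq_iff[symmetric])
qed

lemma recursive_all_less [recursive_intros]:
  fixes n :: "_ \<Rightarrow> nat"
  assumes "recursive (\<lambda>z. P (fst z) (snd z))" "recursive n"
  shows "recursive (\<lambda>x. \<forall>i<n x. P x i)"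
proof -
  have *: "rec_nat True (\<lambda>k r. r \<and> P x k) m \<longleftrightarrow> (\<forall>i<m. P x i)" for x m
    by (induction m) (auto simp: less_Suc_eq)
  have "recursive (\<lambda>x. rec_nat True (\<lambda>k r. r \<and> P x k) (n x))"
    by (intro recursive_intros assms recursive_comp2[where h = P, OF assms(1)])
  then show ?thesis unfolding * .
qed

lemma recursive_ex_less [recursive_intros]:
  fixes n :: "_ \<Rightarrow> nat"
  assumes "recursive (\<lambda>z. P (fst z) (snd z))" "recursive n"
  shows "recursive (\<lambda>x. \<exists>i<n x. P x i)"
proof -
  have "recursive (\<lambda>x. \<not> (\<forall>i<n x. \<not> P x i))"
    by (intro recursive_intros assms)
  then show ?thesis by simp
qed

lemma recursive_ex_le [recursive_intros]:
  fixes n :: "_ \<Rightarrow> nat"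
  assumes "recursive (\<lambda>z. P (fst z) (snd z))" "recursive n"
  shows "recursive (\<lambda>x. \<exists>i\<le>n x. P x i)"
  using recursive_ex_less[OF assms(1) recursive_Suc[OF assms(2)]] by (simp add: less_Suc_eq_le)

lemma recursive_half [recursive_intros]:
  assumes "recursive f" shows "recursive (\<lambda>x. f x div (2::nat))"
proof -
  have *: "rec_nat 0 (\<lambda>k r. if Suc k = 2 * r + 2 then Suc r else r) n = n div 2" for n
  proof (induction n)
    case (Suc n)
    then show ?case by simp presburger
  qed simp
  have "recursive (\<lambda>x. rec_nat 0 (\<lambda>k r. if Suc k = 2 * r + 2 then Suc r else r) (f x))"
    by (intro recursive_intros assms)
  then show ?thesis unfolding * .
qed

lemma recursive_set_decode [recursive_intros]:
  assumes "recursive f" "recursive g" shows "recursive (\<lambda>x. f x \<in> set_decode (g x))"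
proof -
  \<comment> \<open>Halving \<open>t\<close> times moves bit \<open>t\<close> of \<open>s\<close> to
    the last place, where parity reads it.\<close>
  have *: "rec_nat s (\<lambda>k r. r div 2) t = s div 2 ^ t" for s t :: nat
    by (induction t) (auto simp: div_mult2_eq[symmetric] mult.commute)
  have "recursive (\<lambda>x. 2 * (rec_nat (g x) (\<lambda>k r. r div 2) (f x) div 2)
      \<noteq> rec_nat (g x) (\<lambda>k r. r div 2) (f x))"
    by (intro recursive_intros assms)
  moreover have "2 * (n div 2) \<noteq> n \<longleftrightarrow> odd n" for n :: nat by presburger
  ultimately show ?thesis unfolding * by (simp add: set_decode_def)
qed

subsection \<open>Lists\<close>

lemma recursive_Cons [recursive_intros]:
  assumes "recursive f" "recursive g" shows "recursive (\<lambda>x. f x # g x)"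
proof -
  obtain f' g' where f': "computable f'" "\<And>x. f' (enc x) = enc (f x)"
    and g': "computable g'" "\<And>x. g' (enc x) = enc (g x)"
    using assms by (elim recursiveE) (rule that)
  show ?thesis
    by (rule recursiveI[OF computable_comp[OF computable_Suc computable_pair[OF f'(1) g'(1)]]])
      (simp add: f' g' enc_list_def)
qed

lemma recursive_case_list [recursive_intros]:
  assumes "recursive xs" "recursive a" "recursive (\<lambda>z. f (fst z) (fst (snd z)) (snd (snd z)))"
  shows "recursive (\<lambda>x. case xs x of [] \<Rightarrow> a x | y # ys \<Rightarrow> f x y ys)"
proof -
  obtain xs' a' f' where
    xs': "computable xs'" "\<And>x. xs' (enc x) = enc (xs x)" and
    a': "computable a'" "\<And>x. a' (enc x) = enc (a x)" and
    f': "computable f'" "\<And>z. f' (enc z) = enc (f (fst z) (fst (snd z)) (snd (snd z)))"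
    using assms by (elim recursiveE) (rule that)
  \<comment> \<open>The code of a nonempty list is the successor of the pair of head and tail, so
    the predecessor is that pair.\<close>
  have "computable (\<lambda>n. if xs' n = 0 then a' n else f' (prod_encode (n, xs' n - 1)))"
    by (intro computable_if_zero xs' a' computable_comp[OF f'(1)] computable_pair computable_id
        computable_comp[OF computable_pred])
  then show ?thesis
  proof (rule recursiveI)
    fix x
    show "(if xs' (enc x) = 0 then a' (enc x) else f' (prod_encode (enc x, xs' (enc x) - 1)))
      = enc (case xs x of [] \<Rightarrow> a x | y # ys \<Rightarrow> f x y ys)"
    proof (cases "xs x")
      case (Cons y ys)
      have "f' (prod_encode (enc x, prod_encode (enc y, enc ys))) = enc (f x y ys)"
        using f'(2)[of "(x, y, ys)"] by (simp add: enc_prod_def)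
      then show ?thesis using Cons by (simp add: xs' enc_list_def)
    qed (simp add: xs' a' enc_list_def)
  qed
qed

lemma length_le_enc: "length xs \<le> enc xs"
proof (induction xs)
  case (Cons x xs)
  have "enc (x # xs) = Suc (prod_encode (enc x, enc xs))" by (simp add: enc_list_def)
  then show ?case using Cons le_prod_encode_2[of "enc xs" "enc x"] by simp
qed simp

text \<open>The fold becomes an iteration on pairs of accumulator and remaining list. The code of
  the list bounds its length, and surplus rounds change nothing because the list is then
  empty.\<close>

lemma recursive_foldl [recursive_intros]:
  fixes xs :: "'a::encodable \<Rightarrow> 'b::encodable list" and a :: "'a \<Rightarrow> 'c::encodable"
  assumes "recursive (\<lambda>z. f (fst z) (fst (snd z)) (snd (snd z)))" "recursive a" "recursive xs"
  shows "recursive (\<lambda>x. foldl (f x) (a x) (xs x))"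
proof -
  define step where "step = (\<lambda>x z. case snd z of [] \<Rightarrow> (fst z, []) | y # ys \<Rightarrow> (f x (fst z) y, ys))"
  have *: "fst (rec_nat (b, ys) (\<lambda>_. step x) m) = foldl (f x) b ys"
    if "length ys \<le> m" for x b ys m
    using that
  proof (induction m arbitrary: b ys)
    case (Suc m)
    have shift: "rec_nat z (\<lambda>_. g) (Suc m) = rec_nat (g z) (\<lambda>_. g) m" for z and g :: "'c \<times> 'b list \<Rightarrow> 'c \<times> 'b list"
      by (induction m) auto
    show ?case
    proof (cases ys)
      case Nil
      then show ?thesis using Suc.IH[of "[]" b] unfolding shift by (simp add: step_def)
    next
      case (Cons y zs)
      then show ?thesis using Suc.IH[of zs "f x b y"] Suc.prems unfolding shift by (simp add: step_def)
    qed
  qed simp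
  have "recursive (\<lambda>x. fst (rec_nat (a x, xs x) (\<lambda>_. step x) (enc (xs x))))"
    unfolding step_def
    by (intro recursive_intros assms recursive_comp3[where h = f, OF assms(1)])
  then show ?thesis by (simp add: * length_le_enc)
qed

lemma recursive_rev [recursive_intros]:
  assumes "recursive xs" shows "recursive (\<lambda>x. rev (xs x))"
proof -
  have *: "foldl (\<lambda>a y. y # a) bs ys = rev ys @ bs" for ys bs :: "'b list"
    by (induction ys arbitrary: bs) auto
  have "recursive (\<lambda>x. foldl (\<lambda>a y. y # a) [] (xs x))"
    by (intro recursive_intros assms)
  then show ?thesis by (simp add: *)
qed

lemma recursive_append [recursive_intros]:
  assumes "recursive xs" "recursive ys" shows "recursive (\<lambda>x. xs x @ ys x)"
proof -
  have *: "foldl (\<lambda>a y. y # a) bs ys = rev ys @ bs" for ys bs :: "'b list"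
    by (induction ys arbitrary: bs) auto
  have "recursive (\<lambda>x. foldl (\<lambda>a y. y # a) (ys x) (rev (xs x)))"
    by (intro recursive_intros assms)
  then show ?thesis by (simp add: *)
qed

lemma recursive_map [recursive_intros]:
  assumes "recursive (\<lambda>z. f (fst z) (snd z))" "recursive xs"
  shows "recursive (\<lambda>x. map (f x) (xs x))"
proof -
  have *: "foldl (\<lambda>a y. a @ [f x y]) bs ys = bs @ map (f x) ys" for x ys bs
    by (induction ys arbitrary: bs) auto
  have "recursive (\<lambda>x. foldl (\<lambda>a y. a @ [f x y]) [] (xs x))"
    by (intro recursive_intros assms recursive_comp2[where h = f, OF assms(1)])
  then show ?thesis by (simp add: *)
qed

lemma recursive_length [recursive_intros]:
  assumes "recursive xs" shows "recursive (\<lambda>x. length (xs x))"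
proof -
  have *: "foldl (\<lambda>a y. Suc a) k ys = k + length ys" for ys :: "'b list" and k
    by (induction ys arbitrary: k) auto
  have "recursive (\<lambda>x. foldl (\<lambda>a y. Suc a) 0 (xs x))"
    by (intro recursive_intros assms)
  then show ?thesis by (simp add: *)
qed

lemma recursive_sum_list [recursive_intros]:
  fixes xs :: "_ \<Rightarrow> nat list"
  assumes "recursive xs" shows "recursive (\<lambda>x. sum_list (xs x))"
proof -
  have *: "foldl (+) k ys = k + sum_list ys" for ys :: "nat list" and k
    by (induction ys arbitrary: k) auto
  have "recursive (\<lambda>x. foldl (+) 0 (xs x))"
    by (intro recursive_intros assms)
  then show ?thesis by (simp add: *)
qed

lemma recursive_replicate [recursive_intros]:
  assumes "recursive n" "recursive f" shows "recursive (\<lambda>x. replicate (n x) (f x))"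
proof -
  have *: "rec_nat [] (\<lambda>_ r. y # r) k = replicate k y" for k and y :: 'b
    by (induction k) auto
  have "recursive (\<lambda>x. rec_nat [] (\<lambda>_ r. f x # r) (n x))"
    by (intro recursive_intros assms recursive_comp[OF assms(2)])
  then show ?thesis by (simp add: *)
qed

lemma recursive_take [recursive_intros]:
  assumes "recursive n" "recursive xs" shows "recursive (\<lambda>x. take (n x) (xs x))"
proof -
  have drop: "rec_nat ys (\<lambda>_ r. case r of [] \<Rightarrow> [] | _ # zs \<Rightarrow> zs) k = drop k ys" for k and ys :: "'b list"
    by (induction k) (auto split: list.split simp: drop_Suc tl_drop[symmetric]  simp del: tl_drop)
  have "recursive (\<lambda>x. rev (rec_nat (rev (xs x)) (\<lambda>_ r. case r of [] \<Rightarrow> [] | _ # zs \<Rightarrow> zs)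
      (length (xs x) - n x)))"
    by (intro recursive_intros assms)
  moreover have "rev (drop (length ys - k) (rev ys)) = take k ys" for k and ys :: "'b list"
    by (simp add: rev_drop) (cases "k \<le> length ys", auto)
  ultimately show ?thesis unfolding drop by simp
qed

lemma recursive_list_decode [recursive_intros]:
  assumes "recursive f" shows "recursive (\<lambda>x. list_decode (f x))"
proof -
  have "recursive list_decode"
    by (rule recursiveI[OF computable_id]) (simp add: enc_list_def enc_nat_def[abs_def])
  from recursive_comp[OF this assms] show ?thesis .
qed

lemma recursive_n_lists_bool [recursive_intros]:
  assumes "recursive n" shows "recursive (\<lambda>x. List.n_lists (n x) [False, True])"
proof -
  define bl where "bl = (\<lambda>n. rec_nat [[]] (\<lambda>_ r. concat (map (\<lambda>ys. [False # ys, True # ys]) r)) n)"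
  have "foldl (@) zs ys = zs @ concat ys" for ys and zs :: "bool list list"
    by (induction ys arbitrary: zs) auto
  then have *: "concat ys = foldl (@) [] ys" for ys :: "bool list list list"
    by simp
  have "List.n_lists k [False, True] = bl k" for k
    by (induction k) (auto simp: bl_def)
  moreover have "recursive (\<lambda>x. bl (n x))"
    unfolding bl_def * by (intro recursive_intros assms)
  ultimately show ?thesis by simp
qed

subsection \<open>Computably enumerable sets\<close>

text \<open>The search for a witness halts exactly on the members; the test is total, so the
  definedness condition of \<open>partrec.search\<close> holds automatically.\<close>

lemma comp_enumerableI:
  assumes "recursive (\<lambda>z. P (fst z) (snd z))"
  shows "comp_enumerable {x. \<exists>s::nat. P (x::nat) s}"
proof -
  have "recursive (\<lambda>n. if P (fst (prod_decode n)) (snd (prod_decode n)) then 0 else 1::nat)"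
    by (intro recursive_intros recursive_comp2[where h = P, OF assms])
  then have "partrec (\<lambda>n. Some (if P (fst (prod_decode n)) (snd (prod_decode n)) then 0 else 1))"
    unfolding recursive_nat_iff computable_def .
  note search = partrec.search[OF this]
  show ?thesis
    unfolding comp_enumerable_def
    by (rule exI, rule conjI, rule search) (auto simp: dom_def split: if_splits)
qed

lemma uniformly_Sigma01I:
  assumes "recursive (\<lambda>z. P (fst z) (fst (snd z)) (snd (snd z)))"
  shows "uniformly_Sigma01 (\<lambda>i. \<Union>\<sigma>\<in>{\<sigma>. \<exists>s::nat. P i \<sigma> s}. cylinder \<sigma>)"
proof -
  \<comment> \<open>A total decoder that reads every nonzero entry as \<open>True\<close>.
    \<open>W\<close> may therefore contain numbers that are no string codes, but
    \<open>uniformly_Sigma01\<close> only looks at codes.\<close>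
  define str where "str = (\<lambda>n. map (\<lambda>x::nat. x \<noteq> 0) (list_decode n))"
  define W where "W = {n. \<exists>s. P (fst (prod_decode n)) (str (snd (prod_decode n))) s}"
  have "comp_enumerable W"
    unfolding W_def str_def
    by (intro comp_enumerableI recursive_intros recursive_comp3[where h = P, OF assms])
  moreover have "str (str_code \<sigma>) = \<sigma>" for \<sigma>
    by (simp add: str_def str_code_def comp_def)
  ultimately show ?thesis
    unfolding uniformly_Sigma01_def by (intro exI[of _ W]) (simp add: W_def)
qed

section \<open>A universal computably enumerable set\<close>

text \<open>
  A program with number \<open>prod_encode (tag, prod_encode (a, b))\<close> is interpreted through finite
  sets of triples (program, input, output), each of which is justified by other triples of
  the same set. Only such certificates have to be recognised, which needs bounded quantifiers only.
\<close>

definition justified :: "(nat \<Rightarrow> nat \<Rightarrow> nat \<Rightarrow> bool) \<Rightarrow> nat \<Rightarrow> nat \<Rightarrow> nat \<Rightarrow> nat \<Rightarrow> nat \<Rightarrow> nat \<Rightarrow> bool" where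
  "justified P t a b e x y \<longleftrightarrow>
     t = 0 \<and> y = 0
   \<or> t = 1 \<and> y = Suc x
   \<or> t = 2 \<and> y = fst (prod_decode x)
   \<or> t = 3 \<and> y = snd (prod_decode x)
   \<or> t = 4 \<and> P a x (fst (prod_decode y)) \<and> P b x (snd (prod_decode y))
   \<or> t = 5 \<and> (\<exists>z. P b x z \<and> P a z y)
   \<or> t = 6 \<and> snd (prod_decode x) = 0 \<and> P a (fst (prod_decode x)) y
   \<or> t = 6 \<and> snd (prod_decode x) \<noteq> 0 \<and>
       (\<exists>z. P e (prod_encode (fst (prod_decode x), snd (prod_decode x) - 1)) z \<and>
            P b (prod_encode (fst (prod_decode x), prod_encode (snd (prod_decode x) - 1, z))) y)
   \<or> t = 7 \<and> P a (prod_encode (x, y)) 0 \<and> (\<forall>m<y. \<exists>z. z \<noteq> 0 \<and> P a (prod_encode (x, m)) z)"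

lemma justified_simps:
  "justified P 0 a b e x y \<longleftrightarrow> y = 0"
  "justified P (Suc 0) a b e x y \<longleftrightarrow> y = Suc x"
  "justified P 2 a b e x y \<longleftrightarrow> y = fst (prod_decode x)"
  "justified P 3 a b e x y \<longleftrightarrow> y = snd (prod_decode x)"
  "justified P 4 a b e x y \<longleftrightarrow> P a x (fst (prod_decode y)) \<and> P b x (snd (prod_decode y))"
  "justified P 5 a b e x y \<longleftrightarrow> (\<exists>z. P b x z \<and> P a z y)"
  "justified P 6 a b e (prod_encode (u, 0)) y \<longleftrightarrow> P a u y"
  "justified P 6 a b e (prod_encode (u, Suc m)) y \<longleftrightarrow>
    (\<exists>z. P e (prod_encode (u, m)) z \<and> P b (prod_encode (u, prod_encode (m, z))) y)"
  "justified P 7 a b e x y \<longleftrightarrow>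
    P a (prod_encode (x, y)) 0 \<and> (\<forall>m<y. \<exists>z. z \<noteq> 0 \<and> P a (prod_encode (x, m)) z)"
  by (simp_all add: justified_def)

abbreviation prog :: "nat \<Rightarrow> nat \<Rightarrow> nat \<Rightarrow> nat" where
  "prog t a b \<equiv> prod_encode (t, prod_encode (a, b))"

definition justified_program :: "(nat \<Rightarrow> nat \<Rightarrow> nat \<Rightarrow> bool) \<Rightarrow> nat \<Rightarrow> nat \<Rightarrow> nat \<Rightarrow> bool" where
  "justified_program P e = (case prod_decode e of (t, u) \<Rightarrow> case prod_decode u of (a, b) \<Rightarrow> justified P t a b e)"

definition triple_in :: "nat \<Rightarrow> nat \<Rightarrow> nat \<Rightarrow> nat \<Rightarrow> bool" where
  "triple_in s e x y \<longleftrightarrow> prod_encode (e, prod_encode (x, y)) \<in> set_decode s"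

text \<open>No order of derivation is recorded. Circular support does no harm, since a clause of
  \<open>justified\<close> refers only to subprograms or, for tag 6, to the same program at a
  smaller recursion argument.\<close>

definition certificate :: "nat \<Rightarrow> bool" where
  "certificate s \<longleftrightarrow> (\<forall>e x y. triple_in s e x y \<longrightarrow> justified_program (triple_in s) e x y)"

definition derivable :: "nat \<Rightarrow> nat \<Rightarrow> nat \<Rightarrow> bool" where
  "derivable e x y \<longleftrightarrow> (\<exists>s. certificate s \<and> triple_in s e x y)"

lemma set_decode_less: "t \<in> set_decode s \<Longrightarrow> t < s"
proof -
  assume "t \<in> set_decode s"
  then have "2 ^ t \<le> s"
    using div_less[of s "2 ^ t"] by (auto simp: set_decode_def not_less intro: leI)
  then show ?thesis using less_exp[of t] by linarith
qed

text \<open>The position of a set bit is below the number, and a pair dominates its components. This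
  is what bounds every quantifier over triples of \<open>s\<close>.\<close>

lemma triple_in_less:
  assumes "triple_in s e x y" shows "e < s" "x < s" "y < s"
  using set_decode_less[OF assms[unfolded triple_in_def]]
    le_prod_encode_1[of e "prod_encode (x, y)"] le_prod_encode_2[of "prod_encode (x, y)" e]
    le_prod_encode_1[of x y] le_prod_encode_2[of y x]
  by linarith+

lemma justified_mono:
  assumes "justified P t a b e x y" "\<And>e x y. P e x y \<Longrightarrow> Q e x y"
  shows "justified Q t a b e x y"
proof -
  have "justified P t a b e x y \<longrightarrow> justified Q t a b e x y"
    unfolding justified_def
    by (intro imp_refl disj_mono conj_mono ex_mono all_mono imp_mono; blast intro: assms(2))
  then show ?thesis using assms(1) by blast
qed

lemma triple_in_union:
  "triple_in (set_encode (set_decode s \<union> set_decode s')) e x y \<longleftrightarrow> triple_in s e x y \<or> triple_in s' e x y"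
  by (simp add: triple_in_def set_encode_inverse)

lemma certificate_union:
  assumes "certificate s" "certificate s'"
  shows "certificate (set_encode (set_decode s \<union> set_decode s'))"
  unfolding certificate_def
proof (intro allI impI)
  fix e x y assume "triple_in (set_encode (set_decode s \<union> set_decode s')) e x y"
  then have "justified_program (triple_in s) e x y \<or> justified_program (triple_in s') e x y"
    using assms by (auto simp: certificate_def triple_in_union)
  then show "justified_program (triple_in (set_encode (set_decode s \<union> set_decode s'))) e x y"
    unfolding justified_program_def case_prod_unfold
    by (elim disjE; elim justified_mono) (simp_all add: triple_in_union)
qed

lemma common_certificate:
  assumes "finite T" "\<forall>(e, x, y)\<in>T. derivable e x y"
  shows "\<exists>s. certificate s \<and> (\<forall>(e, x, y)\<in>T. triple_in s e x y)"
  using assms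
proof (induction T rule: finite_induct)
  case empty
  have "certificate 0" by (simp add: certificate_def triple_in_def)
  then show ?case by blast
next
  case (insert z T)
  obtain e x y where z: "z = (e, x, y)" by (cases z)
  obtain s where s: "certificate s" "\<forall>(e, x, y)\<in>T. triple_in s e x y" using insert by auto
  obtain s' where s': "certificate s'" "triple_in s' e x y" using insert z by (auto simp: derivable_def)
  show ?case
    using certificate_union[OF s(1) s'(1)] s(2) s'(2) z
    by (intro exI[of _ "set_encode (set_decode s \<union> set_decode s')"]) (auto simp: triple_in_union)
qed

text \<open>Compactness of a single inference: even an unbounded search with result \<open>y\<close>
  inspects only \<open>y + 1\<close> values. Finitely many premises fit into one certificate by
  \<open>common_certificate\<close>.\<close>

lemma justified_finite:
  assumes "justified P t a b e x y"
  shows "\<exists>T. finite T \<and> (\<forall>(e, x, y)\<in>T. P e x y) \<and> justified (\<lambda>e x y. (e, x, y) \<in> T) t a b e x y"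
proof (cases "t = 7")
  case True
  then have P: "P a (prod_encode (x, y)) 0" and "\<forall>m<y. \<exists>z. z \<noteq> 0 \<and> P a (prod_encode (x, m)) z"
    using assms by (simp_all add: justified_def)
  then obtain z where z: "\<And>m. m < y \<Longrightarrow> z m \<noteq> 0 \<and> P a (prod_encode (x, m)) (z m)" by metis
  let ?T = "insert (a, prod_encode (x, y), 0) ((\<lambda>m. (a, prod_encode (x, m), z m)) ` {..<y})"
  have "justified (\<lambda>e x y. (e, x, y) \<in> ?T) t a b e x y"
    unfolding justified_def using z True by auto
  then show ?thesis using P z by (intro exI[of _ ?T]) auto
next
  case False
  then consider "t < 4" | "t = 4" | "t = 5" | "t = 6" "snd (prod_decode x) = 0"
    | "t = 6" "snd (prod_decode x) \<noteq> 0"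
    using assms by (force simp: justified_def)
  then show ?thesis
  proof cases
    case 1
    then show ?thesis using assms by (intro exI[of _ "{}"]) (auto simp: justified_def)
  next
    case 2
    then show ?thesis using assms
      by (intro exI[of _ "{(a, x, fst (prod_decode y)), (b, x, snd (prod_decode y))}"])
        (simp add: justified_def)
  next
    case 3
    then obtain z where "P b x z" "P a z y" using assms by (auto simp: justified_def)
    then show ?thesis using 3 by (intro exI[of _ "{(b, x, z), (a, z, y)}"]) (auto simp: justified_def)
  next
    case 4
    then show ?thesis using assms
      by (intro exI[of _ "{(a, fst (prod_decode x), y)}"]) (simp add: justified_def)
  next
    case 5
    then obtain z where "P e (prod_encode (fst (prod_decode x), snd (prod_decode x) - 1)) z"
      "P b (prod_encode (fst (prod_decode x), prod_encode (snd (prod_decode x) - 1, z))) y"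
      using assms by (auto simp: justified_def)
    then show ?thesis using 5
      by (intro exI[of _ "{(e, prod_encode (fst (prod_decode x), snd (prod_decode x) - 1), z),
          (b, prod_encode (fst (prod_decode x), prod_encode (snd (prod_decode x) - 1, z)), y)}"])
        (auto simp: justified_def)
  qed
qed

text \<open>The fixed point equation that replaces an operational semantics. From left to right it
  is monotonicity; conversely, a common certificate for the finitely many premises is extended by
  the new triple.\<close>

lemma derivable_iff:
  "derivable (prog t a b) x y \<longleftrightarrow> justified derivable t a b (prog t a b) x y" (is "?L \<longleftrightarrow> ?R")
proof
  assume ?L
  then obtain s where s: "certificate s" "triple_in s (prog t a b) x y"
    by (auto simp: derivable_def)
  then have "justified (triple_in s) t a b (prog t a b) x y"
    by (fastforce simp: certificate_def justified_program_def)
  then show ?R by (rule justified_mono) (use s in \<open>auto simp: derivable_def\<close>)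
next
  assume ?R
  from justified_finite[OF this] obtain T where T: "finite T" "\<forall>(e, x, y)\<in>T. derivable e x y"
    "justified (\<lambda>e x y. (e, x, y) \<in> T) t a b (prog t a b) x y" by blast
  from common_certificate[OF T(1,2)] obtain s where
    s: "certificate s" "\<forall>(e, x, y)\<in>T. triple_in s e x y" by blast
  define s' where "s' = set_encode (insert (prod_encode (prog t a b, prod_encode (x, y))) (set_decode s))"
  have s': "triple_in s' e' x' y' \<longleftrightarrow> (e', x', y') = (prog t a b, x, y) \<or> triple_in s e' x' y'" for e' x' y'
    by (auto simp: s'_def triple_in_def set_encode_inverse)
  have "justified (triple_in s') t a b (prog t a b) x y"
    using T(3) by (rule justified_mono) (use s s' in auto)
  moreover have "justified_program (triple_in s') e' x' y'" if "triple_in s e' x' y'" for e' x' y'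
  proof -
    have "justified_program (triple_in s) e' x' y'" using s(1) that by (simp add: certificate_def)
    then show ?thesis
      unfolding justified_program_def case_prod_unfold by (rule justified_mono) (simp add: s')
  qed
  ultimately have "certificate s'"
    unfolding certificate_def s' by (auto simp: justified_program_def)
  then show ?L unfolding derivable_def using s' by blast
qed

lemma partrec_has_program:
  assumes "partrec f"
  shows "\<exists>e. \<forall>x y. f x = Some y \<longleftrightarrow> derivable e x y"
  using assms
proof (induction rule: partrec.induct)
  case zero
  show ?case by (rule exI[of _ "prog 0 0 0"]) (auto simp: derivable_iff justified_simps)
next
  case succ
  show ?case by (rule exI[of _ "prog 1 0 0"]) (auto simp: derivable_iff justified_simps)
next
  case left
  show ?case by (rule exI[of _ "prog 2 0 0"]) (auto simp: derivable_iff justified_simps)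
next
  case right
  show ?case by (rule exI[of _ "prog 3 0 0"]) (auto simp: derivable_iff justified_simps)
next
  case (pair f g)
  then obtain a b where *: "\<And>x y. f x = Some y \<longleftrightarrow> derivable a x y" "\<And>x y. g x = Some y \<longleftrightarrow> derivable b x y"
    by blast
  have "prod_encode (u, v) = y \<longleftrightarrow> u = fst (prod_decode y) \<and> v = snd (prod_decode y)" for u v y
    by (metis fst_conv snd_conv prod.collapse prod_decode_inverse prod_encode_inverse)
  then show ?case
    by (intro exI[of _ "prog 4 a b"]) (auto simp: derivable_iff justified_simps *[symmetric] bind_eq_Some_conv)
next
  case (comp f g)
  then obtain a b where *: "\<And>x y. f x = Some y \<longleftrightarrow> derivable a x y" "\<And>x y. g x = Some y \<longleftrightarrow> derivable b x y"
    by blast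
  show ?case
    by (intro exI[of _ "prog 5 a b"]) (auto simp: derivable_iff justified_simps *[symmetric] bind_eq_Some_conv)
next
  case (prec f g)
  then obtain a b where *: "\<And>x y. f x = Some y \<longleftrightarrow> derivable a x y" "\<And>x y. g x = Some y \<longleftrightarrow> derivable b x y"
    by blast
  define h where "h = (\<lambda>u m. rec_nat (f u)
    (\<lambda>k r. Option.bind r (\<lambda>y. g (prod_encode (u, prod_encode (k, y))))) m)"
  \<comment> \<open>Tag 6 refers to the whole program again, so the structural induction is
    supplemented by one on the recursion argument.\<close>
  have "h u m = Some y \<longleftrightarrow> derivable (prog 6 a b) (prod_encode (u, m)) y" for u m y
  proof (induction m arbitrary: y)
    case 0
    show ?case by (subst derivable_iff) (simp add: justified_simps *[symmetric] h_def)
  next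
    case (Suc m)
    have "h u (Suc m) = Option.bind (h u m) (\<lambda>y. g (prod_encode (u, prod_encode (m, y))))"
      by (simp add: h_def)
    then show ?case
      by (subst derivable_iff) (simp add: justified_simps *[symmetric] Suc.IH[symmetric] bind_eq_Some_conv)
  qed
  then have "(case prod_decode x of (u, m) \<Rightarrow> h u m) = Some y \<longleftrightarrow> derivable (prog 6 a b) x y" for x y
    by (metis case_prod_conv prod.collapse prod_decode_inverse)
  then show ?case unfolding h_def by (intro exI[of _ "prog 6 a b"]) simp
next
  case (search f)
  then obtain a where *: "\<And>x y. f x = Some y \<longleftrightarrow> derivable a x y" by blast
  have defd: "f z \<noteq> None \<longleftrightarrow> (\<exists>y. f z = Some y)" for z by auto
  have "(if \<exists>n. f (prod_encode (x, n)) = Some 0 \<and> (\<forall>m<n. f (prod_encode (x, m)) \<noteq> None)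
      then Some (LEAST n. f (prod_encode (x, n)) = Some 0) else None) = Some y
    \<longleftrightarrow> f (prod_encode (x, y)) = Some 0 \<and> (\<forall>m<y. \<exists>z. z \<noteq> 0 \<and> f (prod_encode (x, m)) = Some z)"
    (is "?S = Some y \<longleftrightarrow> ?R") for x y
  proof
    assume "?S = Some y"
    then obtain n where n: "f (prod_encode (x, n)) = Some 0" "\<forall>m<n. f (prod_encode (x, m)) \<noteq> None"
      and y: "y = (LEAST n. f (prod_encode (x, n)) = Some 0)" by (auto split: if_splits)
    have "f (prod_encode (x, y)) = Some 0" unfolding y using n(1) by (rule LeastI)
    moreover have "y \<le> n" unfolding y using n(1) by (rule Least_le)
    moreover have "f (prod_encode (x, m)) \<noteq> Some 0" if "m < y" for m
      using not_less_Least[of m] that unfolding y by blast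
    ultimately show ?R using n(2) by (metis defd order_less_le_trans)
  next
    assume R: ?R
    then have "(LEAST n. f (prod_encode (x, n)) = Some 0) = y"
      by (intro Least_equality) (auto simp: not_less[symmetric])
    moreover have "\<exists>n. f (prod_encode (x, n)) = Some 0 \<and> (\<forall>m<n. f (prod_encode (x, m)) \<noteq> None)"
      using R by (intro exI[of _ y]) fastforce
    ultimately show "?S = Some y" by simp
  qed
  then show ?case
    by (intro exI[of _ "prog 7 a 0"]) (auto simp: derivable_iff justified_simps *[symmetric])
qed

text \<open>A form of Kleene's T predicate: \<open>s\<close> is at once the certificate and a bound
  for the output, which makes the relation decidable. It is not monotone in
  \<open>s\<close>.\<close>

definition universal :: "nat \<Rightarrow> nat \<Rightarrow> nat \<Rightarrow> bool" where
  "universal e x s \<longleftrightarrow> certificate s \<and> (\<exists>y\<le>s. triple_in s e x y)"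

lemma universal_enumerates:
  assumes "comp_enumerable A"
  shows "\<exists>e. \<forall>x. x \<in> A \<longleftrightarrow> (\<exists>s. universal e x s)"
proof -
  obtain f where f: "partrec f" "A = dom f" using assms by (auto simp: comp_enumerable_def)
  obtain e where "\<forall>x y. f x = Some y \<longleftrightarrow> derivable e x y"
    using partrec_has_program[OF f(1)] by blast
  then have "x \<in> A \<longleftrightarrow> (\<exists>s. universal e x s)" for x
    unfolding f(2) dom_def universal_def derivable_def
    using triple_in_less(3) by (fastforce intro: less_imp_le)
  then show ?thesis by blast
qed

lemma certificate_bounded:
  "certificate s \<longleftrightarrow> (\<forall>e<s. \<forall>x<s. \<forall>y<s. triple_in s e x y \<longrightarrow>
    (let t = fst (prod_decode e); a = fst (prod_decode (snd (prod_decode e)));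
      b = snd (prod_decode (snd (prod_decode e))) in
     t = 0 \<and> y = 0
   \<or> t = 1 \<and> y = Suc x
   \<or> t = 2 \<and> y = fst (prod_decode x)
   \<or> t = 3 \<and> y = snd (prod_decode x)
   \<or> t = 4 \<and> triple_in s a x (fst (prod_decode y)) \<and> triple_in s b x (snd (prod_decode y))
   \<or> t = 5 \<and> (\<exists>z<s. triple_in s b x z \<and> triple_in s a z y)
   \<or> t = 6 \<and> snd (prod_decode x) = 0 \<and> triple_in s a (fst (prod_decode x)) y
   \<or> t = 6 \<and> snd (prod_decode x) \<noteq> 0 \<and>
       (\<exists>z<s. triple_in s e (prod_encode (fst (prod_decode x), snd (prod_decode x) - 1)) z \<and>
            triple_in s b (prod_encode (fst (prod_decode x), prod_encode (snd (prod_decode x) - 1, z))) y)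
   \<or> t = 7 \<and> triple_in s a (prod_encode (x, y)) 0 \<and>
       (\<forall>m<y. \<exists>z<s. z \<noteq> 0 \<and> triple_in s a (prod_encode (x, m)) z)))"
proof -
  have ex1: "(\<exists>z<s. triple_in s b x z \<and> P z) \<longleftrightarrow> (\<exists>z. triple_in s b x z \<and> P z)" for P b x
    using triple_in_less(3) by blast
  have ex2: "(\<exists>z<s. z \<noteq> 0 \<and> triple_in s b x z) \<longleftrightarrow> (\<exists>z. z \<noteq> 0 \<and> triple_in s b x z)" for b x
    using triple_in_less(3) by blast
  have "certificate s \<longleftrightarrow> (\<forall>e<s. \<forall>x<s. \<forall>y<s. triple_in s e x y \<longrightarrow> justified_program (triple_in s) e x y)"
    unfolding certificate_def using triple_in_less by blast
  then show ?thesis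
    unfolding justified_program_def justified_def case_prod_unfold ex1 ex2 Let_def by simp
qed

lemma recursive_triple_in [recursive_intros]:
  assumes "recursive s" "recursive e" "recursive x" "recursive y"
  shows "recursive (\<lambda>z. triple_in (s z) (e z) (x z) (y z))"
  unfolding triple_in_def by (intro recursive_intros assms)

lemma recursive_certificate [recursive_intros]:
  assumes "recursive s" shows "recursive (\<lambda>z. certificate (s z))"
proof -
  have "recursive certificate"
    unfolding certificate_bounded[abs_def] Let_def by (intro recursive_intros)
  from recursive_comp[OF this assms] show ?thesis .
qed

lemma recursive_universal [recursive_intros]:
  assumes "recursive e" "recursive x" "recursive s"
  shows "recursive (\<lambda>z. universal (e z) (x z) (s z))"
  unfolding universal_def by (intro recursive_intros recursive_comp[OF assms(2)]
    recursive_comp[OF assms(1)] recursive_comp[OF assms(3)] assms)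

section \<open>Measures on Cantor space\<close>

definition take_seq :: "nat \<Rightarrow> cantor \<Rightarrow> bool list" where
  "take_seq n X = map X [0..<n]"

lemma length_take_seq [simp]: "length (take_seq n X) = n"
  by (simp add: take_seq_def)

lemma take_seq_0 [simp]: "take_seq 0 X = []"
  by (simp add: take_seq_def)

lemma take_seq_Suc: "take_seq (Suc n) X = take_seq n X @ [X n]"
  by (simp add: take_seq_def)

lemma mem_cylinder_iff: "X \<in> cylinder \<sigma> \<longleftrightarrow> take_seq (length \<sigma>) X = \<sigma>"
proof -
  have "take_seq (length \<sigma>) X = \<sigma> \<longleftrightarrow> (\<forall>i<length \<sigma>. X i = \<sigma> ! i)"
    unfolding take_seq_def list_eq_iff_nth_eq by simp
  then show ?thesis by (metis cylinder_def init_seg_def mem_Collect_eq)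
qed

lemma take_take_seq: "m \<le> n \<Longrightarrow> take m (take_seq n X) = take_seq m X"
  by (simp add: take_seq_def take_map)

lemma prefix_take_seq: "m \<le> n \<Longrightarrow> prefix (take_seq m X) (take_seq n X)"
  by (metis take_take_seq take_is_prefix)

lemma cylinder_Nil [simp]: "cylinder [] = UNIV"
  by (simp add: cylinder_def init_seg_def)

lemma cylinder_mono: "prefix \<sigma> \<tau> \<Longrightarrow> cylinder \<tau> \<subseteq> cylinder \<sigma>"
  unfolding cylinder_def init_seg_def prefix_def
  by (clarsimp simp: nth_append) (metis trans_less_add1)

lemma open_cylinder: "open (cylinder \<sigma>)"
proof -
  have "cylinder \<sigma> = (\<Inter>i\<in>{..<length \<sigma>}. (\<lambda>X. X i) -` {\<sigma> ! i})"
    unfolding cylinder_def init_seg_def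
    by (rule set_eqI, simp only: INT_iff Ball_def mem_Collect_eq lessThan_iff vimage_eq singleton_iff) metis
  moreover have "open ((\<lambda>X :: cantor. X i) -` {\<sigma> ! i})" for i
    by (intro open_vimage continuous_on_product_coordinates
      discrete_topology_class.open_discrete)
  ultimately show ?thesis by (auto intro: open_INT)
qed

lemma cylinder_sets: "cantor_measure \<mu> \<Longrightarrow> cylinder \<sigma> \<in> sets \<mu>"
  by (simp add: cantor_measure_def open_cylinder)

lemma Union_cylinder_sets: "cantor_measure \<mu> \<Longrightarrow> (\<Union>\<sigma>\<in>A. cylinder \<sigma>) \<in> sets \<mu>"
  by (simp add: cantor_measure_def open_cylinder open_UN)

lemma cantor_measure_prob: "cantor_measure \<mu> \<Longrightarrow> prob_space \<mu>"
  by (simp add: cantor_measure_def)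

lemma cantor_measure_finite: "cantor_measure \<mu> \<Longrightarrow> finite_measure \<mu>"
  by (simp add: cantor_measure_def prob_space_def)

lemma measure_cylinder_Nil: "cantor_measure \<mu> \<Longrightarrow> measure \<mu> (cylinder []) = 1"
  using prob_space.prob_space[of \<mu>] sets_eq_imp_space_eq[of \<mu> borel]
  by (auto simp: cantor_measure_def)

lemma ville_inequality:
  assumes \<mu>: "cantor_measure \<mu>"
    and nonneg: "\<And>\<sigma>. 0 \<le> \<phi> \<sigma>"
    and super: "\<And>\<sigma>. measure \<mu> (cylinder (\<sigma> @ [False])) * \<phi> (\<sigma> @ [False])
      + measure \<mu> (cylinder (\<sigma> @ [True])) * \<phi> (\<sigma> @ [True]) \<le> measure \<mu> (cylinder \<sigma>) * \<phi> \<sigma>"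
    and large: "\<And>\<sigma>. \<sigma> \<in> A \<Longrightarrow> r \<le> \<phi> \<sigma>" and "0 < r"
  shows "measure \<mu> (\<Union>\<sigma>\<in>A. cylinder \<sigma>) * r \<le> \<phi> []"
proof -
  interpret finite_measure \<mu> using \<mu> by (rule cantor_measure_finite)
  define E where "E d \<tau> = (\<Union>\<sigma>\<in>{\<sigma>\<in>A. prefix \<tau> \<sigma> \<and> length \<sigma> \<le> length \<tau> + d}. cylinder \<sigma>)" for d \<tau>
  have E_sets: "E d \<tau> \<in> sets \<mu>" for d \<tau>
    unfolding E_def by (rule Union_cylinder_sets[OF \<mu>])
  have in_A: "measure \<mu> (E d \<tau>) * r \<le> measure \<mu> (cylinder \<tau>) * \<phi> \<tau>" if "\<tau> \<in> A" for d \<tau>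
  proof (intro mult_mono)
    show "measure \<mu> (E d \<tau>) \<le> measure \<mu> (cylinder \<tau>)"
      by (rule finite_measure_mono[OF _ cylinder_sets[OF \<mu>]]) (auto simp: E_def dest: cylinder_mono)
  qed (use that large \<open>0 < r\<close> in auto)
  have bound: "measure \<mu> (E d \<tau>) * r \<le> measure \<mu> (cylinder \<tau>) * \<phi> \<tau>" for d \<tau>
  proof (induction d arbitrary: \<tau>)
    case 0
    show ?case
    proof (cases "\<tau> \<in> A")
      case False
      have "E 0 \<tau> = {}"
        using False by (auto simp: E_def prefix_def)
      then show ?thesis by (simp add: nonneg)
    qed (rule in_A)
  next
    case (Suc d)
    show ?case
    proof (cases "\<tau> \<in> A")
      case False
      have "E (Suc d) \<tau> \<subseteq> E d (\<tau> @ [False]) \<union> E d (\<tau> @ [True])"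
      proof
        fix X assume "X \<in> E (Suc d) \<tau>"
        then obtain \<sigma> where \<sigma>: "\<sigma> \<in> A" "prefix \<tau> \<sigma>" "length \<sigma> \<le> length \<tau> + Suc d" "X \<in> cylinder \<sigma>"
          by (auto simp: E_def)
        then obtain b \<rho> where "\<sigma> = \<tau> @ b # \<rho>"
          using False by (metis append_Nil2 neq_Nil_conv prefixE)
        then have "X \<in> E d (\<tau> @ [b])" using \<sigma> by (auto simp: E_def)
        then show "X \<in> E d (\<tau> @ [False]) \<union> E d (\<tau> @ [True])" by (cases b) auto
      qed
      then have "measure \<mu> (E (Suc d) \<tau>) \<le> measure \<mu> (E d (\<tau> @ [False]) \<union> E d (\<tau> @ [True]))"
        by (intro finite_measure_mono sets.Un E_sets)
      also have "\<dots> \<le> measure \<mu> (E d (\<tau> @ [False])) + measure \<mu> (E d (\<tau> @ [True]))"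
        by (intro measure_Un_le E_sets)
      finally have "measure \<mu> (E (Suc d) \<tau>) * r
          \<le> measure \<mu> (E d (\<tau> @ [False])) * r + measure \<mu> (E d (\<tau> @ [True])) * r"
        using \<open>0 < r\<close> by (metis distrib_right mult_right_mono less_imp_le)
      then show ?thesis
        using Suc[of "\<tau> @ [False]"] Suc[of "\<tau> @ [True]"] super[of \<tau>] by linarith
    qed (rule in_A)
  qed
  have "incseq (\<lambda>d. E d [])"
    by (rule incseq_SucI) (auto simp: E_def)
  then have "(\<lambda>d. measure \<mu> (E d [])) \<longlonglongrightarrow> measure \<mu> (\<Union>d. E d [])"
    by (intro finite_Lim_measure_incseq) (auto intro: E_sets)
  moreover have "(\<Union>d. E d []) = (\<Union>\<sigma>\<in>A. cylinder \<sigma>)"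
    by (auto simp: E_def)
  ultimately have "(\<lambda>d. measure \<mu> (E d []) * r) \<longlonglongrightarrow> measure \<mu> (\<Union>\<sigma>\<in>A. cylinder \<sigma>) * r"
    by (auto intro: tendsto_mult_right)
  moreover have "measure \<mu> (E d []) * r \<le> \<phi> []" for d
    using bound[of d "[]"] measure_cylinder_Nil[OF \<mu>] by simp
  ultimately show ?thesis
    by (intro LIMSEQ_le_const2) auto
qed

text \<open>Each string of \<open>F\<close> is refined to its extensions of length \<open>s\<close>,
  whose cylinders are disjoint. The sum over a list is the form that a recursive function can
  evaluate.\<close>

lemma measure_Union_cylinders:
  assumes \<mu>: "cantor_measure \<mu>" and F: "\<And>\<sigma>. \<sigma> \<in> F \<Longrightarrow> length \<sigma> \<le> s"
  shows "measure \<mu> (\<Union>\<sigma>\<in>F. cylinder \<sigma>)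
    = (\<Sum>\<tau>\<leftarrow>List.n_lists s [False, True]. if \<exists>k\<le>s. take k \<tau> \<in> F then measure \<mu> (cylinder \<tau>) else 0)"
proof -
  interpret finite_measure \<mu> using \<mu> by (rule cantor_measure_finite)
  define G where "G = {\<tau>. length \<tau> = s \<and> (\<exists>k\<le>s. take k \<tau> \<in> F)}"
  have fin: "finite {\<tau> :: bool list. length \<tau> = s}"
    using finite_lists_length_eq[of "UNIV :: bool set" s] by simp
  have set: "set (List.n_lists s [False, True]) = {\<tau>. length \<tau> = s}"
    by (auto simp: set_n_lists)
  have "(\<Union>\<sigma>\<in>F. cylinder \<sigma>) = (\<Union>\<tau>\<in>G. cylinder \<tau>)"
  proof (intro equalityI subsetI)
    fix X assume "X \<in> (\<Union>\<sigma>\<in>F. cylinder \<sigma>)"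
    then obtain \<sigma> where \<sigma>: "\<sigma> \<in> F" "X \<in> cylinder \<sigma>" by blast
    then have "take (length \<sigma>) (take_seq s X) = \<sigma>"
      using F by (simp add: mem_cylinder_iff take_take_seq)
    then have "take_seq s X \<in> G"
      unfolding G_def using \<sigma>(1) F[OF \<sigma>(1)]
      by (intro CollectI conjI exI[of _ "length \<sigma>"]) simp_all
    then show "X \<in> (\<Union>\<tau>\<in>G. cylinder \<tau>)"
      by (intro UN_I[of "take_seq s X"]) (auto simp: mem_cylinder_iff)
  next
    fix X assume "X \<in> (\<Union>\<tau>\<in>G. cylinder \<tau>)"
    then obtain \<tau> k where "take k \<tau> \<in> F" "X \<in> cylinder \<tau>" by (auto simp: G_def)
    then show "X \<in> (\<Union>\<sigma>\<in>F. cylinder \<sigma>)"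
      using cylinder_mono[OF take_is_prefix[of k \<tau>]] by blast
  qed
  moreover have "disjoint_family_on cylinder G"
    by (auto simp: disjoint_family_on_def G_def mem_cylinder_iff)
  moreover have "finite G" using fin by (rule rev_finite_subset) (auto simp: G_def)
  ultimately have "measure \<mu> (\<Union>\<sigma>\<in>F. cylinder \<sigma>) = (\<Sum>\<tau>\<in>G. measure \<mu> (cylinder \<tau>))"
    using finite_measure_finite_Union[of G cylinder] cylinder_sets[OF \<mu>] by auto
  also have "\<dots> = (\<Sum>\<tau>\<in>{\<tau>. length \<tau> = s}. if \<exists>k\<le>s. take k \<tau> \<in> F then measure \<mu> (cylinder \<tau>) else 0)"
    using fin by (simp add: sum.If_cases G_def Collect_conj_eq)
  also have "\<dots> = (\<Sum>\<tau>\<leftarrow>List.n_lists s [False, True]. if \<exists>k\<le>s. take k \<tau> \<in> F then measure \<mu> (cylinder \<tau>) else 0)"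
    by (subst sum_list_distinct_conv_sum_set) (auto simp: distinct_n_lists set)
  finally show ?thesis .
qed

text \<open>
  The usual construction: enumerate all computably enumerable sets, but stop enumerating
  the \<open>j\<close>-th section before its measure exceeds \<open>2\<^sup>-\<^sup>j\<close>.
  The rational masses make the stopping condition decidable.
\<close>

lemma universal_test_exists:
  assumes \<mu>: "cantor_measure \<mu>"
    and M: "recursive M" "\<And>\<sigma>. measure \<mu> (cylinder \<sigma>) * 2 ^ length \<sigma> = real (M \<sigma>)"
  obtains U where "MartinLof_test \<mu> U" "\<And>V i. MartinLof_test \<mu> V \<Longrightarrow> \<exists>j. V j \<subseteq> U i"
proof -
  interpret finite_measure \<mu> using \<mu> by (rule cantor_measure_finite)
  \<comment> \<open>\<open>universal\<close> is not monotone in its stage, hence the search over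
    \<open>t\<close>. The bound on \<open>enc \<sigma>\<close> also bounds the length, so a stage is
    measured by strings of length \<open>s\<close>.\<close>
  define stage where
    "stage = (\<lambda>e j s \<sigma>. enc \<sigma> \<le> s \<and> (\<exists>t\<le>s. universal e (prod_encode (j, enc (\<sigma> :: bool list))) t))"
  define weight where
    "weight = (\<lambda>e j s. \<Sum>\<tau>\<leftarrow>List.n_lists s [False, True]. if \<exists>k\<le>s. stage e j s (take k \<tau>) then M \<tau> else 0)"
  define small where "small = (\<lambda>e j s. weight e j s * 2 ^ j \<le> (2::nat) ^ s)"
  define G where "G = (\<lambda>e j s. \<Union>\<sigma>\<in>{\<sigma>. stage e j s \<sigma>}. cylinder \<sigma>)"
  \<comment> \<open>Since \<open>G\<close> grows with the stage, the small stages form an initial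
    segment: enumeration goes on until the bound would be violated.\<close>
  define trimmed where "trimmed = (\<lambda>e j. \<Union>s\<in>{s. small e j s}. G e j s)"
  \<comment> \<open>The shift of the index makes the bounds add up: 2^-(i+e+1) summed over all e is
    2^-i.\<close>
  define U where "U = (\<lambda>i. \<Union>e. trimmed e (Suc (i + e)))"

  have G_sets: "G e j s \<in> sets \<mu>" for e j s
    unfolding G_def by (rule Union_cylinder_sets[OF \<mu>])
  have trimmed_sets: "trimmed e j \<in> sets \<mu>" for e j
    unfolding trimmed_def by (intro sets.countable_UN'' G_sets countableI_type)
  have stage_length: "stage e j s \<sigma> \<Longrightarrow> length \<sigma> \<le> s" for e j s \<sigma>
    using length_le_enc[of \<sigma>] by (simp add: stage_def)
  have G_mono: "G e j s \<subseteq> G e j s'" if "s \<le> s'" for e j s s'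
    using that unfolding G_def stage_def by (intro UN_mono) (auto intro: order_trans)

  have sum_list_real: "(\<Sum>x\<leftarrow>xs. real (f x) * c) = real (\<Sum>x\<leftarrow>xs. f x) * c" for xs f c
    by (induction xs) (auto simp: distrib_right)
  have measure_G: "measure \<mu> (G e j s) = real (weight e j s) / 2 ^ s" for e j s
  proof -
    have "measure \<mu> (G e j s) = (\<Sum>\<tau>\<leftarrow>List.n_lists s [False, True].
        if \<exists>k\<le>s. take k \<tau> \<in> {\<sigma>. stage e j s \<sigma>} then measure \<mu> (cylinder \<tau>) else 0)"
      unfolding G_def using stage_length by (intro measure_Union_cylinders[OF \<mu>]) auto
    also have "\<dots> = (\<Sum>\<tau>\<leftarrow>List.n_lists s [False, True].
        real (if \<exists>k\<le>s. stage e j s (take k \<tau>) then M \<tau> else 0) * (1 / 2 ^ s))"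
    proof (intro arg_cong[where f = sum_list] map_cong refl)
      fix \<tau> assume "\<tau> \<in> set (List.n_lists s [False, True])"
      then have "length \<tau> = s" by (simp add: set_n_lists)
      then show "(if \<exists>k\<le>s. take k \<tau> \<in> {\<sigma>. stage e j s \<sigma>} then measure \<mu> (cylinder \<tau>) else 0)
          = real (if \<exists>k\<le>s. stage e j s (take k \<tau>) then M \<tau> else 0) * (1 / 2 ^ s)"
        using M(2)[of \<tau>] by (auto simp: field_simps)
    qed
    also have "\<dots> = real (weight e j s) / 2 ^ s"
      unfolding weight_def sum_list_real by simp
    finally show ?thesis .
  qed
  have small_iff: "small e j s \<longleftrightarrow> measure \<mu> (G e j s) \<le> (1/2) ^ j" for e j s
  proof -
    have "small e j s \<longleftrightarrow> real (weight e j s * 2 ^ j) \<le> real (2 ^ s)"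
      unfolding small_def of_nat_le_iff ..
    then show ?thesis by (simp add: measure_G field_simps power_divide)
  qed

  have trimmed_le: "measure \<mu> (trimmed e j) \<le> (1/2) ^ j" for e j
  proof -
    define H where "H = (\<lambda>n. \<Union>s\<in>{s. s \<le> n \<and> small e j s}. G e j s)"
    have H_le: "measure \<mu> (H n) \<le> (1/2) ^ j" for n
    proof (cases "{s. s \<le> n \<and> small e j s} = {}")
      case False
      define m where "m = Max {s. s \<le> n \<and> small e j s}"
      have fin: "finite {s. s \<le> n \<and> small e j s}" by simp
      have "m \<in> {s. s \<le> n \<and> small e j s}"
        unfolding m_def using fin False by (rule Max_in)
      moreover have "H n \<subseteq> G e j m"
        unfolding H_def using Max_ge[OF fin] G_mono unfolding m_def by blast
      ultimately show ?thesis
        using finite_measure_mono[OF \<open>H n \<subseteq> G e j m\<close> G_sets] small_iff by (auto intro: order_trans)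
    next
      case True
      show ?thesis unfolding H_def True by simp
    qed
    have "incseq H"
      unfolding H_def by (intro incseq_SucI UN_mono) auto
    moreover have "H n \<in> sets \<mu>" for n
      unfolding H_def by (intro sets.countable_UN'' G_sets countableI_type)
    ultimately have "(\<lambda>n. measure \<mu> (H n)) \<longlonglongrightarrow> measure \<mu> (\<Union>n. H n)"
      by (intro finite_Lim_measure_incseq) auto
    moreover have "(\<Union>n. H n) = trimmed e j"
      by (auto simp: H_def trimmed_def)
    ultimately show ?thesis using H_le by (intro LIMSEQ_le_const2) auto
  qed

  have U_le: "measure \<mu> (U i) \<le> (1/2) ^ i" for i
  proof -
    have sums: "(\<lambda>e. (1/2) ^ Suc (i + e) :: real) sums (1/2) ^ i"
      using sums_mult[OF power_half_series, of "(1/2) ^ i"] by (simp add: power_add mult_ac)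
    have summ: "summable (\<lambda>e. measure \<mu> (trimmed e (Suc (i + e))))"
      by (rule summable_comparison_test'[OF sums_summable[OF sums], of 0]) (simp only: real_norm_def abs_of_nonneg measure_nonneg trimmed_le)
    have "measure \<mu> (U i) \<le> (\<Sum>e. measure \<mu> (trimmed e (Suc (i + e))))"
      unfolding U_def using trimmed_sets summ
      by (intro finite_measure_subadditive_countably) auto
    also have "\<dots> \<le> (\<Sum>e. (1/2) ^ Suc (i + e))"
      by (intro suminf_le trimmed_le summ sums_summable[OF sums])
    also have "\<dots> = (1/2) ^ i" using sums by (rule sums_unique[symmetric])
    finally show ?thesis .
  qed

  have "recursive (\<lambda>z. stage (fst z) (fst (snd z)) (fst (snd (snd z))) (snd (snd (snd z))))"
    unfolding stage_def by (intro recursive_intros)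
  note rec_stage = recursive_comp4[where h = stage, OF this]
  have "recursive (\<lambda>z. small (fst z) (fst (snd z)) (snd (snd z)))"
    unfolding small_def weight_def
    by (intro recursive_intros rec_stage recursive_comp[OF M(1)])
  note rec_small = recursive_comp3[where h = small, OF this]
  have "recursive (\<lambda>z. stage (fst (prod_decode (snd (snd z)))) (Suc (fst z + fst (prod_decode (snd (snd z)))))
        (snd (prod_decode (snd (snd z)))) (fst (snd z)) \<and>
      small (fst (prod_decode (snd (snd z)))) (Suc (fst z + fst (prod_decode (snd (snd z)))))
        (snd (prod_decode (snd (snd z)))))"
    by (intro recursive_intros rec_stage rec_small)
  from uniformly_Sigma01I[where P = "\<lambda>i \<sigma> p. stage (fst (prod_decode p)) (Suc (i + fst (prod_decode p)))
      (snd (prod_decode p)) \<sigma> \<and> small (fst (prod_decode p)) (Suc (i + fst (prod_decode p)))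
      (snd (prod_decode p))", OF this]
  have "uniformly_Sigma01 (\<lambda>i. \<Union>\<sigma>\<in>{\<sigma>. \<exists>p. stage (fst (prod_decode p)) (Suc (i + fst (prod_decode p)))
      (snd (prod_decode p)) \<sigma> \<and> small (fst (prod_decode p)) (Suc (i + fst (prod_decode p)))
      (snd (prod_decode p))}. cylinder \<sigma>)" .
  moreover have "(\<exists>p. stage (fst (prod_decode p)) (Suc (i + fst (prod_decode p)))
      (snd (prod_decode p)) \<sigma> \<and> small (fst (prod_decode p)) (Suc (i + fst (prod_decode p)))
      (snd (prod_decode p))) \<longleftrightarrow> (\<exists>e s. stage e (Suc (i + e)) s \<sigma> \<and> small e (Suc (i + e)) s)" for i \<sigma>
    by (metis fst_conv snd_conv prod_encode_inverse)
  moreover have "U = (\<lambda>i. \<Union>\<sigma>\<in>{\<sigma>. \<exists>e s. stage e (Suc (i + e)) s \<sigma> \<and> small e (Suc (i + e)) s}. cylinder \<sigma>)"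
    by (auto simp: U_def trimmed_def G_def)
  ultimately have "MartinLof_test \<mu> U"
    unfolding MartinLof_test_def using U_le by (simp only: simp_thms)
  moreover have "\<exists>j. V j \<subseteq> U i" if V: "MartinLof_test \<mu> V" for V i
  proof -
    obtain W where W: "comp_enumerable W"
      "\<And>i. V i = (\<Union>\<sigma>\<in>{\<sigma>. prod_encode (i, enc \<sigma>) \<in> W}. cylinder \<sigma>)"
      using V unfolding MartinLof_test_def uniformly_Sigma01_def str_code_eq_enc by blast
    obtain e where e: "\<And>x. x \<in> W \<longleftrightarrow> (\<exists>s. universal e x s)"
      using universal_enumerates[OF W(1)] by blast
    \<comment> \<open>A genuine test is never cut off, because every stage of its enumeration lies
      inside a set that already obeys the bound.\<close>
    have "V (Suc (i + e)) \<subseteq> trimmed e (Suc (i + e))"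
    proof
      fix X assume "X \<in> V (Suc (i + e))"
      then obtain \<sigma> t where \<sigma>: "universal e (prod_encode (Suc (i + e), enc \<sigma>)) t" "X \<in> cylinder \<sigma>"
        unfolding W(2) e by blast
      define s where "s = max t (enc \<sigma>)"
      have "X \<in> G e (Suc (i + e)) s"
        using \<sigma> unfolding G_def stage_def s_def by (auto intro!: exI[of _ \<sigma>] exI[of _ t])
      moreover have "G e (Suc (i + e)) s \<subseteq> V (Suc (i + e))"
        unfolding G_def W(2) e stage_def by blast
      then have "measure \<mu> (G e (Suc (i + e)) s) \<le> measure \<mu> (V (Suc (i + e)))"
        unfolding W(2) by (intro finite_measure_mono Union_cylinder_sets[OF \<mu>])
      then have "small e (Suc (i + e)) s"
        unfolding small_iff using V unfolding MartinLof_test_def by (meson order_trans)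
      ultimately show "X \<in> trimmed e (Suc (i + e))" by (auto simp: trimmed_def)
    qed
    then show ?thesis unfolding U_def by blast
  qed
  ultimately show ?thesis using that by blast
qed

section \<open>Clocks for the computable functions\<close>

text \<open>
  \<open>clock e\<close> is advanced at stage \<open>s\<close> when the computation of \<open>f (b + e + 2)\<close> has terminated
  with a value at most \<open>s\<close>, where \<open>b\<close> is the stage of the previous advance and \<open>f\<close> is the
  function whose graph has index \<open>e - 2\<close>. The offset leaves room for the \<open>e + 1\<close> bits by
  which a block below chooses \<open>e\<close>. The first two clocks stand still, which keeps the total mass
  of the atoms below 1.
\<close>

definition resolved :: "nat \<Rightarrow> nat \<Rightarrow> nat \<Rightarrow> bool" where
  "resolved e b s \<longleftrightarrow> 2 \<le> e \<and> (\<exists>y\<le>s. \<exists>t\<le>s. universal (e - 2) (prod_encode (b + e + 2, y)) t)"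

definition advance :: "nat \<Rightarrow> nat \<Rightarrow> nat \<times> nat" where
  "advance e = rec_nat (0, 0) (\<lambda>s r. if resolved e (fst r) (Suc s) then (Suc s, Suc (snd r)) else r)"

definition clock :: "nat \<Rightarrow> nat \<Rightarrow> nat" where
  "clock e s = snd (advance e s)"

lemma advance_simps:
  "advance e 0 = (0, 0)"
  "advance e (Suc s) = (if resolved e (fst (advance e s)) (Suc s)
     then (Suc s, Suc (snd (advance e s))) else advance e s)"
  by (simp_all add: advance_def)

lemma recursive_clock [recursive_intros]:
  assumes "recursive e" "recursive s" shows "recursive (\<lambda>x. clock (e x) (s x))"
  unfolding clock_def advance_def resolved_def
  by (intro recursive_intros assms recursive_comp[OF assms(1)])

lemma clock_Suc: "clock e s \<le> clock e (Suc s)"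
  by (simp add: clock_def advance_simps)

lemma clock_mono: "s \<le> t \<Longrightarrow> clock e s \<le> clock e t"
  using lift_Suc_mono_le[of "clock e"] clock_Suc by blast

lemma clock_less_imp_less: "clock e s < clock e t \<Longrightarrow> s < t"
  using clock_mono[of t s e] by (meson not_le)

lemma clock_trivial: "e < 2 \<Longrightarrow> clock e s = 0"
  by (induction s) (auto simp: clock_def advance_simps resolved_def)

lemma advance_eq:
  assumes "s \<le> t" "clock e s = clock e t" shows "advance e t = advance e s"
  using assms
proof (induction t rule: dec_induct)
  case (step t)
  have "clock e t = clock e s"
    using step.prems clock_Suc[of e t] clock_mono[OF step.hyps(1), of e] by linarith
  then have "\<not> resolved e (fst (advance e t)) (Suc t)"
    using step.prems by (auto simp: clock_def advance_simps)
  then show ?case using step.IH \<open>clock e t = clock e s\<close> by (simp add: advance_simps)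
qed simp

text \<open>Locates the first advance after \<open>m\<close>. The base is unchanged until then, so
  the value found at \<open>t\<close> is the one requested at stage \<open>m\<close>.\<close>

lemma clock_less_imp_advance:
  "clock e m < clock e s \<Longrightarrow>
    \<exists>t. m < t \<and> t \<le> s \<and> resolved e (fst (advance e m)) t \<and> fst (advance e t) = t \<and> clock e t = Suc (clock e m)"
proof (induction s)
  case 0
  then show ?case by (auto dest: clock_less_imp_less)
next
  case (Suc s)
  show ?case
  proof (cases "clock e m < clock e s")
    case True
    then show ?thesis using Suc.IH le_SucI by blast
  next
    case False
    have "m \<le> s" using clock_less_imp_less[OF Suc.prems] by simp
    then have "clock e m = clock e s" using clock_mono[of m s e] False by simp
    then have eq: "advance e s = advance e m" using advance_eq[OF \<open>m \<le> s\<close>] by simp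
    have "resolved e (fst (advance e s)) (Suc s)"
      using Suc.prems \<open>clock e m = clock e s\<close> by (auto simp: clock_def advance_simps split: if_splits)
    then show ?thesis
      using eq \<open>m \<le> s\<close> by (intro exI[of _ "Suc s"]) (auto simp: clock_def advance_simps)
  qed
qed

text \<open>Totality keeps the clock running. For the gap, the first advance after \<open>m\<close>
  makes some \<open>t > m\<close> the base, and the second is triggered by the value
  \<open>f (t + e + 2)\<close>. So \<open>n = t + e + 1\<close> works, because a strictly increasing
  function dominates the identity.\<close>

lemma clock_for_function:
  assumes f: "computable f" "strict_mono f"
  obtains e where "\<And>k. \<exists>s. k \<le> clock e s"
    and "\<And>m s. clock e m + 2 \<le> clock e s \<Longrightarrow> \<exists>n. m + e + 1 \<le> f n \<and> f (Suc n) \<le> s"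
proof -
  have "recursive f" using f(1) by (simp add: recursive_nat_iff)
  then have "comp_enumerable {x. \<exists>s::nat. f (fst (prod_decode x)) = snd (prod_decode x)}"
    by (intro comp_enumerableI recursive_intros recursive_comp[OF \<open>recursive f\<close>])
  then obtain e' where
    e': "\<And>x. f (fst (prod_decode x)) = snd (prod_decode x) \<longleftrightarrow> (\<exists>s. universal e' x s)"
    using universal_enumerates by force
  define e where "e = e' + 2"
  have univ: "(\<exists>t. universal (e - 2) (prod_encode (n, y)) t) \<longleftrightarrow> f n = y" for n y
    using e'[of "prod_encode (n, y)"] by (simp add: e_def)
  have gap: "\<exists>n. m + e + 1 \<le> f n \<and> f (Suc n) \<le> s" if "clock e m + 2 \<le> clock e s" for m s
  proof -
    have "clock e m < clock e s" using that by simp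
    from clock_less_imp_advance[OF this]
    obtain t where t: "m < t" "fst (advance e t) = t" "clock e t = Suc (clock e m)"
      by blast
    then have "clock e t < clock e s" using that by simp
    from clock_less_imp_advance[OF this] obtain u where u: "u \<le> s" "resolved e t u"
      using t(2) by auto
    then obtain y v where "y \<le> u" "universal (e - 2) (prod_encode (t + e + 2, y)) v"
      unfolding resolved_def by blast
    then have "f (t + e + 2) \<le> u" using univ[of "t + e + 2" y] by auto
    moreover have "t + e + 1 \<le> f (t + e + 1)" by (rule strict_mono_imp_increasing[OF f(2)])
    ultimately show ?thesis using t u by (intro exI[of _ "t + e + 1"]) simp
  qed
  have "\<exists>s. k \<le> clock e s" for k
  proof (induction k)
    case (Suc k)
    then obtain s where s: "k \<le> clock e s" by blast
    define b where "b = fst (advance e s)"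
    obtain t where t: "universal (e - 2) (prod_encode (b + e + 2, f (b + e + 2))) t"
      using univ[of "b + e + 2" "f (b + e + 2)"] by auto
    \<comment> \<open>By stage \<open>Suc u\<close> the awaited value and its witness are available:
      either the clock has moved by stage \<open>u\<close>, or its base is still \<open>b\<close>
      and it moves at \<open>Suc u\<close>.\<close>
    define u where "u = max s (max t (f (b + e + 2)))"
    have "s \<le> u" by (simp add: u_def)
    have "f (b + e + 2) \<le> Suc u" "t \<le> Suc u" by (simp_all add: u_def)
    then have "resolved e b (Suc u)" using t unfolding resolved_def by (auto simp: e_def)
    show ?case
    proof (cases "clock e s = clock e u")
      case True
      then have "advance e u = advance e s" using advance_eq[OF \<open>s \<le> u\<close>] by simp
      then have "clock e (Suc u) = Suc (clock e s)"
        using \<open>resolved e b (Suc u)\<close> by (simp add: clock_def advance_simps b_def)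
      then show ?thesis using s by (intro exI[of _ "Suc u"]) simp
    next
      case False
      then show ?thesis using clock_mono[OF \<open>s \<le> u\<close>, of e] s by (intro exI[of _ u]) simp
    qed
  qed simp
  then show ?thesis using that gap by blast
qed

section \<open>The measure\<close>

text \<open>
  A sequence is read in blocks. A block starting at \<open>q\<close>, whose predecessor started at \<open>p\<close>,
  chooses \<open>e\<close> by \<open>1\<^sup>e0\<close>; if clock \<open>e\<close> has advanced between \<open>p\<close> and \<open>q\<close>, zeros follow until it
  has advanced twice more. The state consists of the current length, \<open>p\<close>, \<open>q\<close>, the number of
  ones read in the block and the information whether we are waiting.
\<close>

type_synonym state = "nat \<times> nat \<times> nat \<times> nat \<times> bool"

text \<open>\<open>p\<close> and \<open>q\<close> are fixed before the block chooses an index, so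
  its start settles for which indices it would wait. Release is tested at \<open>Suc l\<close>, the
  length after the current bit; the bit itself is ignored while waiting, a one having mass zero
  there.\<close>

definition step :: "state \<Rightarrow> bool \<Rightarrow> state" where
  "step st x = (case st of (l, p, q, j, w) \<Rightarrow>
     if w then (if clock j q + 2 \<le> clock j (Suc l) then (Suc l, q, Suc l, 0, False) else (Suc l, p, q, j, True))
     else if x then (Suc l, p, q, Suc j, False)
     else if clock j p < clock j q then (Suc l, p, q, j, True)
     else (Suc l, q, Suc l, 0, False))"

definition run :: "bool list \<Rightarrow> state" where
  "run = foldl step (0, 0, 0, 0, False)"

definition is_waiting :: "state \<Rightarrow> bool" where
  "is_waiting st = snd (snd (snd (snd st)))"

definition waiting :: "bool list \<Rightarrow> bool" where
  "waiting \<sigma> = is_waiting (run \<sigma>)"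

text \<open>The mass of \<open>\<sigma>\<close>, multiplied by \<open>2 ^ length \<sigma>\<close>: a bit is forced while waiting and a fair
  coin flip otherwise.\<close>

definition scaled_mass :: "bool list \<Rightarrow> nat" where
  "scaled_mass \<sigma> = snd (foldl (\<lambda>r x. (step (fst r) x,
     if is_waiting (fst r) then if x then 0 else 2 * snd r else snd r)) ((0, 0, 0, 0, False), 1) \<sigma>)"

lemma step_simp:
  "step (l, p, q, j, w) x =
    (if w then (if clock j q + 2 \<le> clock j (Suc l) then (Suc l, q, Suc l, 0, False) else (Suc l, p, q, j, True))
     else if x then (Suc l, p, q, Suc j, False)
     else if clock j p < clock j q then (Suc l, p, q, j, True)
     else (Suc l, q, Suc l, 0, False))"
  by (simp add: step_def)

lemma run_Nil [simp]: "run [] = (0, 0, 0, 0, False)"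
  by (simp add: run_def)

lemma run_snoc: "run (\<sigma> @ [x]) = step (run \<sigma>) x"
  by (simp add: run_def)

lemma is_waiting_simp [simp]: "is_waiting (l, p, q, j, w) = w"
  by (simp add: is_waiting_def)

lemma scaled_mass_Nil [simp]: "scaled_mass [] = 1"
  by (simp add: scaled_mass_def)

lemma scaled_mass_snoc:
  "scaled_mass (\<sigma> @ [x]) =
    (if waiting \<sigma> then if x then 0 else 2 * scaled_mass \<sigma> else scaled_mass \<sigma>)"
proof -
  let ?g = "\<lambda>r x. (step (fst r) x,
     if is_waiting (fst r) then if x then 0 else 2 * snd r else snd r :: nat)"
  have "fst (foldl ?g ((0, 0, 0, 0, False), 1) \<sigma>) = run \<sigma>" for \<sigma>
    by (induction \<sigma> rule: rev_induct) (simp_all add: run_snoc)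
  then show ?thesis by (simp add: scaled_mass_def waiting_def)
qed

lemma recursive_step [recursive_intros]:
  assumes "recursive st" "recursive x" shows "recursive (\<lambda>z. step (st z) (x z))"
  unfolding step_def case_prod_unfold
  by (intro recursive_intros recursive_comp[OF assms(1)] assms)

lemma recursive_is_waiting [recursive_intros]:
  assumes "recursive st" shows "recursive (\<lambda>z. is_waiting (st z))"
  unfolding is_waiting_def by (intro recursive_intros assms)

lemma recursive_scaled_mass: "recursive scaled_mass"
  unfolding scaled_mass_def[abs_def] by (intro recursive_intros)

text \<open>Realizes the measure as an image of fair coin flips: a coin is overwritten by
  \<open>False\<close> where the prefix built so far is waiting.\<close>

primrec coin_path :: "cantor \<Rightarrow> nat \<Rightarrow> bool list" where
  "coin_path Z 0 = []"
| "coin_path Z (Suc n) = coin_path Z n @ [Z n \<and> \<not> waiting (coin_path Z n)]"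

definition walk :: "cantor \<Rightarrow> cantor" where
  "walk Z n = (Z n \<and> \<not> waiting (coin_path Z n))"

lemma length_coin_path [simp]: "length (coin_path Z n) = n"
  by (induction n) auto

lemma take_seq_walk: "take_seq n (walk Z) = coin_path Z n"
  by (induction n) (auto simp: take_seq_Suc walk_def)

definition free_positions :: "bool list \<Rightarrow> nat set" where
  "free_positions \<sigma> = {i. i < length \<sigma> \<and> \<not> waiting (take i \<sigma>)}"

lemma free_positions_snoc:
  "free_positions (\<sigma> @ [x]) = (if waiting \<sigma> then free_positions \<sigma> else insert (length \<sigma>) (free_positions \<sigma>))"
  by (auto simp: free_positions_def less_Suc_eq)

lemma finite_free_positions: "finite (free_positions \<sigma>)"
  by (simp add: free_positions_def)

lemma scaled_mass_free_positions:
  "scaled_mass \<sigma> \<noteq> 0 \<Longrightarrow> scaled_mass \<sigma> * 2 ^ card (free_positions \<sigma>) = 2 ^ length \<sigma>"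
proof (induction \<sigma> rule: rev_induct)
  case Nil
  show ?case by (simp add: free_positions_def)
next
  case (snoc x \<sigma>)
  have "length \<sigma> \<notin> free_positions \<sigma>" by (simp add: free_positions_def)
  then show ?case
    using snoc finite_free_positions[of \<sigma>]
    by (auto simp: scaled_mass_snoc free_positions_snoc split: if_splits)
qed

text \<open>Reduces a cylinder to finitely many independent coins. The other coins are discarded,
  and nonzero \<open>scaled_mass\<close> says that \<sigma> has no one at a forced position.\<close>

lemma coin_path_eq_iff:
  "coin_path Z (length \<sigma>) = \<sigma> \<longleftrightarrow> scaled_mass \<sigma> \<noteq> 0 \<and> (\<forall>i\<in>free_positions \<sigma>. Z i = \<sigma> ! i)"
proof (induction \<sigma> rule: rev_induct)
  case Nil
  show ?case by (simp add: free_positions_def)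
next
  case (snoc x \<sigma>)
  have "(\<forall>i\<in>free_positions \<sigma>. Z i = (\<sigma> @ [x]) ! i) \<longleftrightarrow> (\<forall>i\<in>free_positions \<sigma>. Z i = \<sigma> ! i)"
    by (auto simp: free_positions_def nth_append)
  then show ?case
    using snoc by (cases "waiting \<sigma>") (auto simp: scaled_mass_snoc free_positions_snoc)
qed

text \<open>Lets measurability into the Borel sets of the product be checked on coordinates, as in
  \<open>measurable_walk\<close>.\<close>

instance bool :: second_countable_topology
proof
  have "open = generate_topology (UNIV :: bool set set)"
    by (auto simp: fun_eq_iff discrete_topology_class.open_discrete intro: generate_topology.Basis)
  then show "\<exists>B::bool set set. countable B \<and> open = generate_topology B"
    by (intro exI[of _ UNIV] conjI) (auto intro: countable_finite)
qed

section \<open>The distribution of the overwritten coin flips\<close>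

abbreviation coin :: "bool measure" where
  "coin \<equiv> measure_pmf (bernoulli_pmf (1/2))"

abbreviation coins :: "cantor measure" where
  "coins \<equiv> PiM UNIV (\<lambda>_. coin)"

lemma product_prob_space_coins: "product_prob_space (\<lambda>_::nat. coin)"
  by unfold_locales

lemma prob_space_coins: "prob_space coins"
  by (rule prob_space_PiM) (rule prob_space_measure_pmf)

lemma space_coins: "space coins = UNIV"
  by (simp add: space_PiM PiE_UNIV_domain)

lemma measurable_coin: "(\<lambda>Z. Z n) \<in> coins \<rightarrow>\<^sub>M count_space UNIV"
proof -
  have "(\<lambda>Z. Z n) \<in> coins \<rightarrow>\<^sub>M coin" by (rule measurable_component_singleton) simp
  then show ?thesis using measurable_cong_sets[OF refl sets_measure_pmf_count_space] by blast
qed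

lemma measurable_coin_path: "(\<lambda>Z. coin_path Z n) \<in> coins \<rightarrow>\<^sub>M count_space UNIV"
proof (induction n)
  case (Suc n)
  have "(\<lambda>Z. \<sigma> @ [Z n \<and> \<not> waiting \<sigma>]) \<in> coins \<rightarrow>\<^sub>M count_space UNIV" for \<sigma>
    by (rule measurable_compose[OF measurable_coin]) simp
  from measurable_compose_countable[OF this Suc] show ?case by simp
qed simp

lemma measurable_walk: "walk \<in> coins \<rightarrow>\<^sub>M borel"
proof -
  have "(\<lambda>Z. walk Z n) \<in> coins \<rightarrow>\<^sub>M borel" for n
  proof -
    have "(\<lambda>Z. Z n \<and> \<not> waiting \<sigma>) \<in> coins \<rightarrow>\<^sub>M borel" for \<sigma>
      by (rule measurable_compose[OF measurable_coin]) simp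
    from measurable_compose_countable[OF this measurable_coin_path] show ?thesis
      by (simp add: walk_def)
  qed
  then show ?thesis by (rule measurable_coordinatewise_then_product)
qed

definition slow_measure :: "cantor measure" where
  "slow_measure = distr coins borel walk"

lemma cantor_measure_slow: "cantor_measure slow_measure"
  unfolding cantor_measure_def slow_measure_def
  using prob_space.prob_space_distr[OF prob_space_coins measurable_walk] by simp

lemma measure_slow_cylinder:
  "measure slow_measure (cylinder \<sigma>) * 2 ^ length \<sigma> = real (scaled_mass \<sigma>)"
proof -
  have "measure slow_measure (cylinder \<sigma>) = measure coins {Z. coin_path Z (length \<sigma>) = \<sigma>}"
  proof -
    have "walk -` cylinder \<sigma> = {Z. coin_path Z (length \<sigma>) = \<sigma>}"
      by (rule set_eqI) (simp only: vimage_eq mem_cylinder_iff take_seq_walk mem_Collect_eq)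
    moreover have "cylinder \<sigma> \<in> sets borel" by (rule borel_open[OF open_cylinder])
    ultimately show ?thesis
      unfolding slow_measure_def by (simp only: measure_distr[OF measurable_walk] space_coins Int_UNIV_right)
  qed
  also have "\<dots> * 2 ^ length \<sigma> = real (scaled_mass \<sigma>)"
  proof (cases "scaled_mass \<sigma> = 0")
    case False
    interpret product_prob_space "\<lambda>_::nat. coin" UNIV by (rule product_prob_space_coins)
    have "emeasure coins {Z \<in> space coins. \<forall>i\<in>free_positions \<sigma>. Z i \<in> {\<sigma> ! i}}
        = (\<Prod>i\<in>free_positions \<sigma>. emeasure coin {\<sigma> ! i})"
      by (rule emeasure_PiM_Collect) (auto simp: finite_free_positions)
    also have "\<dots> = (\<Prod>i\<in>free_positions \<sigma>. ennreal (1/2))"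
    proof (rule prod.cong)
      show "emeasure coin {\<sigma> ! i} = ennreal (1/2)" for i
        by (cases "\<sigma> ! i") (simp_all add: emeasure_pmf_single)
    qed simp
    also have "\<dots> = ennreal ((1/2) ^ card (free_positions \<sigma>))"
      unfolding prod_constant by (rule ennreal_power) simp
    finally have "measure coins {Z. coin_path Z (length \<sigma>) = \<sigma>} = (1/2) ^ card (free_positions \<sigma>)"
      using False by (simp add: measure_def coin_path_eq_iff space_coins)
    moreover have "(2::real) ^ length \<sigma> = real (scaled_mass \<sigma> * 2 ^ card (free_positions \<sigma>))"
      unfolding scaled_mass_free_positions[OF False] by simp
    ultimately show ?thesis by (simp add: power_divide)
  qed (simp add: coin_path_eq_iff)
  finally show ?thesis .
qed

lemma computable_measure_slow: "computable_measure slow_measure"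
proof -
  \<comment> \<open>Even codes stand for the nonnegative integers under \<open>int_decode\<close>,
    hence the doubled numerator and denominator. The approximation is exact at every
    precision.\<close>
  have "recursive (\<lambda>\<sigma>. prod_encode (2 * scaled_mass \<sigma>, 2 * 2 ^ length \<sigma>))"
    by (intro recursive_intros recursive_scaled_mass)
  then have "recursive (\<lambda>z::bool list \<times> nat. prod_encode (2 * scaled_mass (fst z), 2 * 2 ^ length (fst z)))"
    using recursive_comp[OF _ recursive_fst[OF recursive_id]] by blast
  then obtain g where g: "computable g"
    "\<And>z::bool list \<times> nat. g (enc z) = enc (prod_encode (2 * scaled_mass (fst z), 2 * 2 ^ length (fst z)))"
    unfolding recursive_def by blast
  have g': "g (prod_encode (str_code \<sigma>, n)) = prod_encode (2 * scaled_mass \<sigma>, 2 * 2 ^ length \<sigma>)" for \<sigma> n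
    using g(2)[of "(\<sigma>, n)"] by (simp add: str_code_eq_enc enc_prod_def enc_nat_def)
  have decode: "int_decode (2 * k) = int k" for k
    by (simp add: int_decode_def sum_decode_def)
  have rat: "of_rat (nat_to_rat_surj (prod_encode (2 * k, 2 * 2 ^ n))) = real k / 2 ^ n" for k n
    using decode[of k] decode[of "2 ^ n"] by (simp add: nat_to_rat_surj_def of_rat_rat)
  have "measure slow_measure (cylinder \<sigma>) = real (scaled_mass \<sigma>) / 2 ^ length \<sigma>" for \<sigma>
    using measure_slow_cylinder[of \<sigma>] by (simp add: field_simps)
  then show ?thesis
    unfolding computable_measure_def computable_real_on_strings_def
    using cantor_measure_slow g(1) g' rat by (intro conjI exI[of _ g]) auto
qed

lemma measure_slow_snoc:
  "measure slow_measure (cylinder (\<sigma> @ [x])) =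
    (if waiting \<sigma> then if x then 0 else measure slow_measure (cylinder \<sigma>)
     else measure slow_measure (cylinder \<sigma>) / 2)"
proof -
  have eq: "measure slow_measure (cylinder \<tau>) = real (scaled_mass \<tau>) / 2 ^ length \<tau>" for \<tau>
    using measure_slow_cylinder[of \<tau>] by (simp add: field_simps)
  show ?thesis unfolding eq by (simp add: scaled_mass_snoc)
qed

text \<open>While waiting, the extension by a one has mass zero and only the extension by a zero
  counts; otherwise both carry half of the mass.\<close>

lemma slow_measure_ville:
  assumes nonneg: "\<And>\<sigma>. 0 \<le> \<phi> \<sigma>"
    and forced: "\<And>\<sigma>. waiting \<sigma> \<Longrightarrow> \<phi> (\<sigma> @ [False]) \<le> \<phi> \<sigma>"
    and free: "\<And>\<sigma>. \<not> waiting \<sigma> \<Longrightarrow> \<phi> (\<sigma> @ [False]) + \<phi> (\<sigma> @ [True]) \<le> 2 * \<phi> \<sigma>"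
    and "\<And>\<sigma>. \<sigma> \<in> A \<Longrightarrow> r \<le> \<phi> \<sigma>" and "0 < r"
  shows "measure slow_measure (\<Union>\<sigma>\<in>A. cylinder \<sigma>) * r \<le> \<phi> []"
proof (rule ville_inequality[OF cantor_measure_slow])
  fix \<sigma>
  let ?m = "measure slow_measure (cylinder \<sigma>)"
  show "measure slow_measure (cylinder (\<sigma> @ [False])) * \<phi> (\<sigma> @ [False])
      + measure slow_measure (cylinder (\<sigma> @ [True])) * \<phi> (\<sigma> @ [True]) \<le> ?m * \<phi> \<sigma>"
  proof (cases "waiting \<sigma>")
    case True
    then show ?thesis using forced by (simp add: measure_slow_snoc mult_left_mono)
  next
    case False
    have "?m / 2 * (\<phi> (\<sigma> @ [False]) + \<phi> (\<sigma> @ [True])) \<le> ?m / 2 * (2 * \<phi> \<sigma>)"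
      by (intro mult_left_mono free False) simp
    then show ?thesis using False by (simp add: measure_slow_snoc distrib_left)
  qed
qed (use assms in auto)

text \<open>A wait chosen by \<open>j\<close> ones and a closing zero begins at length
  \<open>q + j + 1\<close>; the clause for \<open>take\<close> recovers that beginning from any
  later prefix of the same wait.\<close>

lemma run_invariant:
  "run \<sigma> = (l, p, q, j, w) \<Longrightarrow> l = length \<sigma> \<and> p \<le> q \<and> q \<le> l \<and>
    (if w then q + j + 1 \<le> l \<and> clock j p < clock j q \<and> run (take (q + j + 1) \<sigma>) = (q + j + 1, p, q, j, True)
     else l = q + j)"
proof (induction \<sigma> arbitrary: l p q j w rule: rev_induct)
  case (snoc x \<sigma>)
  obtain l' p' q' j' w' where st: "run \<sigma> = (l', p', q', j', w')" by (cases "run \<sigma>")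
  note IH = snoc.IH[OF st]
  have eq: "(l, p, q, j, w) = step (l', p', q', j', w') x"
    using snoc.prems st by (simp add: run_snoc)
  show ?case
  proof (cases w)
    case False
    then show ?thesis using eq IH by (auto simp: step_simp split: if_splits)
  next
    case True
    show ?thesis
    proof (cases w')
      case True
      then show ?thesis using eq IH \<open>w\<close> by (auto simp: step_simp split: if_splits)
    next
      case False
      then have "(l, p, q, j, w) = (Suc l', p', q', j', True)" "clock j' p' < clock j' q'"
        using eq \<open>w\<close> by (auto simp: step_simp split: if_splits)
      then show ?thesis using IH False snoc.prems by auto
    qed
  qed
qed simp

lemma waiting_iff: "run \<sigma> = (l, p, q, j, w) \<Longrightarrow> waiting \<sigma> \<longleftrightarrow> w"
  by (simp add: waiting_def)

section \<open>The measure is not trivial\<close>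

text \<open>Every block counted here starts after a fresh advance, at a clock value of at least K -
  1 and at most K. Along a sequence these values increase, so there are at most two such blocks,
  each choosing \<open>e\<close> with probability 2^-(e+1). The supermartingale \<open>val\<close>
  makes this precise.\<close>

lemma stuck_waiting_bound:
  assumes bounded: "\<And>s. clock e s \<le> K"
  shows "measure slow_measure (\<Union>\<sigma>\<in>{\<sigma>. \<exists>l p q. run \<sigma> = (l, p, q, e, True) \<and> K < clock e q + 2}. cylinder \<sigma>)
    \<le> (1/2) ^ e"
proof -
  define \<alpha> :: real where "\<alpha> = (1/2) ^ Suc e"
  txt \<open>At most two values of the clock can be the last ones seen by a block that waits forever;
    \<open>base q\<close> accounts for those still ahead of a block starting at \<open>q\<close>.\<close>
  define base where "base = (\<lambda>q. real (min (K - clock e q) 2) * \<alpha>)"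
  \<comment> \<open>After \<open>j\<close> ones the block chooses \<open>e\<close> with conditional
    probability 2^-(e-j+1): \<open>e - j\<close> more ones and a zero. In a wait the summand
    indicates the event to be bounded.\<close>
  define val where "val = (\<lambda>st :: state. case st of (l, p, q, j, w) \<Rightarrow> base q +
    (if w then of_bool (j = e \<and> K < clock e q + 2)
     else if clock e p < clock e q \<and> K < clock e q + 2 \<and> j \<le> e then (1/2) ^ Suc (e - j) else 0))"
  have base_nonneg: "0 \<le> base q" for q by (simp add: base_def \<alpha>_def)
  have val_simp: "val (l, p, q, j, w) = base q +
    (if w then of_bool (j = e \<and> K < clock e q + 2)
     else if clock e p < clock e q \<and> K < clock e q + 2 \<and> j \<le> e then (1/2) ^ Suc (e - j) else 0)"
    for l p q j w by (simp add: val_def)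
  \<comment> \<open>A block whose wait for \<open>e\<close> may be final uses up one of the
    remaining clock values: \<open>base\<close> drops by at least \<alpha>, which pays for the new
    summand.\<close>
  have block: "val (l, q, l, 0, False) \<le> base q" if "q \<le> l" for l q
  proof (cases "clock e q < clock e l \<and> K < clock e l + 2")
    case True
    then have "min (K - clock e l) 2 + 1 \<le> min (K - clock e q) 2"
      using bounded[of l] by linarith
    then have "real (min (K - clock e l) 2 + 1) * \<alpha> \<le> real (min (K - clock e q) 2) * \<alpha>"
      by (intro mult_right_mono, unfold of_nat_le_iff) (simp_all add: \<alpha>_def)
    then show ?thesis using True by (simp add: val_simp base_def \<alpha>_def algebra_simps)
  next
    case False
    have "min (K - clock e l) 2 \<le> min (K - clock e q) 2"
      using clock_mono[OF that, of e] by linarith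
    then have "real (min (K - clock e l) 2) * \<alpha> \<le> real (min (K - clock e q) 2) * \<alpha>"
      by (intro mult_right_mono) (simp_all add: \<alpha>_def)
    then show ?thesis using False by (auto simp: val_simp base_def)
  qed
  have "measure slow_measure (\<Union>\<sigma>\<in>{\<sigma>. \<exists>l p q. run \<sigma> = (l, p, q, e, True) \<and> K < clock e q + 2}. cylinder \<sigma>) * 1
      \<le> val (run [])"
  proof (rule slow_measure_ville)
    fix \<sigma>
    obtain l p q j w where st: "run \<sigma> = (l, p, q, j, w)" by (cases "run \<sigma>")
    have ql: "q \<le> l" using run_invariant[OF st] by simp
    then have block': "val (Suc l, q, Suc l, 0, False) \<le> base q" by (intro block) simp
    show "0 \<le> val (run \<sigma>)" using base_nonneg by (auto simp: st val_simp)
    show "val (run (\<sigma> @ [False])) \<le> val (run \<sigma>)" if "waiting \<sigma>"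
    proof -
      have w: "w" using that waiting_iff[OF st] by simp
      show ?thesis
      proof (cases "clock j q + 2 \<le> clock j (Suc l)")
        case True
        then have "step (l, p, q, j, w) False = (Suc l, q, Suc l, 0, False)" using w by (simp add: step_simp)
        moreover have "base q \<le> val (l, p, q, j, w)" using w by (simp add: val_simp)
        ultimately show ?thesis using block' by (simp add: st run_snoc)
      next
        case False
        then have "step (l, p, q, j, w) False = (Suc l, p, q, j, True)" using w by (simp add: step_simp)
        then show ?thesis using w by (simp add: st run_snoc val_simp)
      qed
    qed
    show "val (run (\<sigma> @ [False])) + val (run (\<sigma> @ [True])) \<le> 2 * val (run \<sigma>)" if "\<not> waiting \<sigma>"
    proof -
      have w: "\<not> w" using that waiting_iff[OF st] by simp
      have T: "val (run (\<sigma> @ [True])) = val (Suc l, p, q, Suc j, False)"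
        using w by (simp add: st run_snoc step_simp)
      show ?thesis
      proof (cases "clock j p < clock j q")
        case True
        then have F: "val (run (\<sigma> @ [False])) = val (Suc l, p, q, j, True)"
          using w by (simp add: st run_snoc step_simp)
        consider "j < e" | "j = e" | "e < j" by linarith
        then show ?thesis
        proof cases
          case 1
          then have "Suc (e - j) = Suc (Suc (e - Suc j))" by simp
          then show ?thesis unfolding T F st using w 1 by (simp add: val_simp)
        next
          case 2
          then show ?thesis unfolding T F st using w True by (simp add: val_simp)
        next
          case 3
          then show ?thesis unfolding T F st using w by (simp add: val_simp)
        qed
      next
        case False
        then have F: "val (run (\<sigma> @ [False])) \<le> base q"
          using w block' by (simp add: st run_snoc step_simp)
        show ?thesis
        proof (cases "j < e")
          case True
          then have "Suc (e - j) = Suc (Suc (e - Suc j))" by simp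
          then show ?thesis using F unfolding T st using w True by (simp add: val_simp)
        next
          case False
          then show ?thesis
            using F \<open>\<not> clock j p < clock j q\<close> unfolding T st using w by (auto simp: val_simp)
        qed
      qed
    qed
  next
    fix \<sigma> assume "\<sigma> \<in> {\<sigma>. \<exists>l p q. run \<sigma> = (l, p, q, e, True) \<and> K < clock e q + 2}"
    then show "1 \<le> val (run \<sigma>)" using base_nonneg by (auto simp: val_simp)
  qed simp
  also have "val (run []) \<le> 2 * \<alpha>"
    by (simp add: val_simp base_def \<alpha>_def mult_right_mono)
  finally show ?thesis by (simp add: \<alpha>_def)
qed

text \<open>A release always leads to a state that is not waiting. So the block is kept forever, and
  its clock never gets two advances beyond its value at \<open>q\<close>.\<close>

lemma waiting_forever:
  assumes "\<And>n. n0 \<le> n \<Longrightarrow> waiting (take_seq n X)"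
  obtains p q j where "\<And>n. n0 \<le> n \<Longrightarrow> run (take_seq n X) = (n, p, q, j, True)"
    "\<And>s. clock j s < clock j q + 2"
proof -
  obtain l p q j w where st: "run (take_seq n0 X) = (l, p, q, j, w)" by (cases "run (take_seq n0 X)")
  have "w" using assms[of n0] waiting_iff[OF st] by simp
  moreover have "l = n0" using run_invariant[OF st] by simp
  ultimately have st: "run (take_seq n0 X) = (n0, p, q, j, True)" using st by simp
  have run: "run (take_seq n X) = (n, p, q, j, True)" if "n0 \<le> n" for n
    using that
  proof (induction n rule: dec_induct)
    case (step n)
    have "waiting (take_seq (Suc n) X)" using assms step.hyps by simp
    then show ?case
      using step.IH by (auto simp: take_seq_Suc run_snoc step_simp waiting_def split: if_splits)
  qed (rule st)
  have "clock j (Suc n) < clock j q + 2" if "n0 \<le> n" for n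
    using run[OF that] run[of "Suc n"] that
    by (auto simp: take_seq_Suc run_snoc step_simp split: if_splits)
  then have "clock j s < clock j q + 2" for s
    using clock_mono[of s "Suc (max s n0)" j] by (meson le_SucI le_less_trans max.cobounded1 max.cobounded2)
  with run show ?thesis using that by blast
qed

text \<open>Each free position halves the mass, and waiting in between cannot increase it.\<close>

lemma infinitely_often_free_measure:
  assumes "\<And>n. \<exists>m\<ge>n. \<not> waiting (take_seq m X)"
  shows "\<exists>n. measure slow_measure (cylinder (take_seq n X)) \<le> (1/2) ^ k"
proof (induction k)
  case 0
  show ?case
    using prob_space.prob_le_1[OF cantor_measure_prob[OF cantor_measure_slow]] by auto
next
  case (Suc k)
  interpret finite_measure slow_measure by (rule cantor_measure_finite[OF cantor_measure_slow])
  obtain n where n: "measure slow_measure (cylinder (take_seq n X)) \<le> (1/2) ^ k" using Suc by blast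
  obtain m where m: "n \<le> m" "\<not> waiting (take_seq m X)" using assms by blast
  have "measure slow_measure (cylinder (take_seq m X)) \<le> measure slow_measure (cylinder (take_seq n X))"
    by (intro finite_measure_mono cylinder_mono prefix_take_seq m cylinder_sets cantor_measure_slow)
  then show ?case
    using n m(2) by (intro exI[of _ "Suc m"]) (simp add: take_seq_Suc measure_slow_snoc)
qed

lemma atom_waiting_forever:
  assumes "X \<in> atoms slow_measure"
  shows "\<exists>n0. \<forall>n\<ge>n0. waiting (take_seq n X)"
proof (rule ccontr)
  assume "\<not> ?thesis"
  then have free: "\<And>n. \<exists>m\<ge>n. \<not> waiting (take_seq m X)" by blast
  interpret finite_measure slow_measure by (rule cantor_measure_finite[OF cantor_measure_slow])
  have pos: "0 < measure slow_measure {X}" using assms by (simp add: atoms_def)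
  then obtain k where k: "(1/2) ^ k < measure slow_measure {X}"
    using real_arch_pow_inv[of "measure slow_measure {X}" "1/2"] by auto
  obtain n where n: "measure slow_measure (cylinder (take_seq n X)) \<le> (1/2) ^ k"
    using infinitely_often_free_measure[OF free] by blast
  have "measure slow_measure {X} \<le> measure slow_measure (cylinder (take_seq n X))"
    by (intro finite_measure_mono cylinder_sets cantor_measure_slow) (simp add: mem_cylinder_iff)
  then show False using n k by linarith
qed

lemma not_trivial_slow: "\<not> trivial_measure slow_measure"
proof -
  interpret finite_measure slow_measure by (rule cantor_measure_finite[OF cantor_measure_slow])
  define bounded where "bounded = (\<lambda>e. \<exists>K. \<forall>s. clock e s \<le> K)"
  \<comment> \<open>For a bounded clock this is the final value, so a wait with
    \<open>K e < clock e q + 2\<close> never ends.\<close>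
  define K where "K = (\<lambda>e. LEAST K. \<forall>s. clock e s \<le> K)"
  define B where "B = (\<lambda>e. \<Union>\<sigma>\<in>{\<sigma>. bounded e \<and> (\<exists>l p q. run \<sigma> = (l, p, q, e, True) \<and> K e < clock e q + 2)}. cylinder \<sigma>)"
  have B_sets: "B e \<in> sets slow_measure" for e
    unfolding B_def by (rule Union_cylinder_sets[OF cantor_measure_slow])
  have B_le: "measure slow_measure (B e) \<le> (1/2) ^ e" for e
  proof (cases "bounded e")
    case True
    then have "\<forall>s. clock e s \<le> K e" unfolding bounded_def K_def by (rule LeastI_ex)
    then show ?thesis using stuck_waiting_bound[of e "K e"] True by (simp add: B_def)
  qed (simp add: B_def)
  have "atoms slow_measure \<subseteq> (\<Union>e. B (e + 2))"
  proof
    fix X assume "X \<in> atoms slow_measure"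
    then obtain n0 where "\<And>n. n0 \<le> n \<Longrightarrow> waiting (take_seq n X)"
      using atom_waiting_forever by blast
    then obtain p q j where run: "\<And>n. n0 \<le> n \<Longrightarrow> run (take_seq n X) = (n, p, q, j, True)"
      and lt: "\<And>s. clock j s < clock j q + 2"
      by (elim waiting_forever) (rule that)
    have le: "\<forall>s. clock j s \<le> clock j q + 1" using lt by (simp add: less_Suc_eq_le)
    then have "bounded j" "K j < clock j q + 2"
      using Least_le[of "\<lambda>K. \<forall>s. clock j s \<le> K", OF le] by (auto simp: bounded_def K_def)
    then have "X \<in> B j"
      unfolding B_def using run[of n0] by (auto simp: mem_cylinder_iff intro!: exI[of _ "take_seq n0 X"])
    \<comment> \<open>A wait presupposes an advance between \<open>p\<close> and \<open>q\<close>,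
      which the two idle clocks never make. Hence the sum below starts with 2^-2.\<close>
    moreover have "2 \<le> j"
      using run_invariant[OF run[of n0]] clock_trivial[of j] by (cases "j < 2") auto
    ultimately show "X \<in> (\<Union>e. B (e + 2))" by (intro UN_I[of "j - 2"]) (auto simp: le_add_diff_inverse2 simp del: add_2_eq_Suc')
  qed
  moreover have "measure slow_measure (\<Union>e. B (e + 2)) \<le> 1/2"
  proof -
    have sums: "(\<lambda>e. (1/2) ^ (e + 2) :: real) sums (1/2)"
      using sums_mult[OF power_half_series, of "1/2"] by simp
    have summ: "summable (\<lambda>e. measure slow_measure (B (e + 2)))"
      by (rule summable_comparison_test'[OF sums_summable[OF sums], of 0])
        (simp only: real_norm_def abs_of_nonneg measure_nonneg B_le)
    have "measure slow_measure (\<Union>e. B (e + 2)) \<le> (\<Sum>e. measure slow_measure (B (e + 2)))"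
      using B_sets summ by (intro finite_measure_subadditive_countably) auto
    also have "\<dots> \<le> (\<Sum>e. (1/2) ^ (e + 2))"
      by (intro suminf_le B_le summ sums_summable[OF sums])
    also have "\<dots> = 1/2" using sums by (rule sums_unique[symmetric])
    finally show ?thesis .
  qed
  moreover have "measure slow_measure (atoms slow_measure) \<le> measure slow_measure (\<Union>e. B (e + 2))"
    using calculation(1) B_sets by (intro finite_measure_mono) auto
  ultimately show ?thesis unfolding trivial_measure_def by simp
qed

section \<open>The measure is diminutive\<close>

text \<open>
  The score counts the blocks in which clock \<open>e\<close> has newly advanced. It drops to zero for good
  as soon as the sequence waits for clock \<open>e\<close>.
\<close>

definition score_step :: "nat \<Rightarrow> state \<times> nat \<Rightarrow> bool \<Rightarrow> state \<times> nat" where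
  "score_step e r x = (let st = step (fst r) x in
     (st, case st of (l, p, q, j, w) \<Rightarrow>
        if snd r = 0 \<or> w \<and> j = e then 0
        else if q = l \<and> clock e p < clock e q then Suc (snd r) else snd r))"

text \<open>The initial value is 1 because 0 is absorbing and marks the strings that have waited for
  \<open>e\<close>.\<close>

definition score :: "nat \<Rightarrow> bool list \<Rightarrow> nat" where
  "score e \<sigma> = snd (foldl (score_step e) ((0, 0, 0, 0, False), 1) \<sigma>)"

lemma score_Nil [simp]: "score e [] = 1"
  by (simp add: score_def)

lemma score_snoc:
  "score e (\<sigma> @ [x]) = (case run (\<sigma> @ [x]) of (l, p, q, j, w) \<Rightarrow>
     if score e \<sigma> = 0 \<or> w \<and> j = e then 0
     else if q = l \<and> clock e p < clock e q then Suc (score e \<sigma>) else score e \<sigma>)"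
proof -
  have "fst (foldl (score_step e) ((0, 0, 0, 0, False), 1) \<sigma>) = run \<sigma>"
    by (induction \<sigma> rule: rev_induct) (simp_all add: run_snoc score_step_def Let_def)
  then have pair: "foldl (score_step e) ((0, 0, 0, 0, False), 1) \<sigma> = (run \<sigma>, score e \<sigma>)"
    by (intro prod_eqI) (simp_all only: score_def fst_conv snd_conv)
  have "score e (\<sigma> @ [x]) = snd (score_step e (foldl (score_step e) ((0, 0, 0, 0, False), 1) \<sigma>) x)"
    by (simp only: score_def foldl_append foldl.simps)
  then show ?thesis by (simp only: pair score_step_def Let_def fst_conv snd_conv run_snoc)
qed

lemma recursive_score: "recursive (score e)"
  unfolding score_def[abs_def] score_step_def Let_def case_prod_unfold by (intro recursive_intros)

text \<open>\<open>g\<close> is the inverse of the probability that a block does not choose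
  \<open>e\<close>, so surviving an opportunity multiplies the capital by \<open>g\<close>. Inside a
  block the capital is scaled by the conditional probability of not choosing \<open>e\<close>. That
  is at least 1/2, hence the factor 1/2; the initial score 1 gives the initial capital
  \<open>g\<close>.\<close>

lemma score_measure_bound:
  fixes e k :: nat
  defines "g \<equiv> 1 / (1 - (1/2) ^ Suc e) :: real"
  assumes "0 < k"
  shows "measure slow_measure (\<Union>\<sigma>\<in>{\<sigma>. k \<le> score e \<sigma>}. cylinder \<sigma>) * (g ^ k / 2) \<le> g"
proof -
  txt \<open>The capital of a gambler who bets, in every block where clock \<open>e\<close> has newly advanced,
    that \<open>e\<close> is not chosen.\<close>
  define val where "val = (\<lambda>\<sigma>. if score e \<sigma> = 0 then 0 else g ^ score e \<sigma> *
    (case run \<sigma> of (l, p, q, j, w) \<Rightarrow>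
      if \<not> w \<and> clock e p < clock e q \<and> j \<le> e then 1 - (1/2) ^ Suc (e - j) else 1))"
  have half: "(1/2 :: real) ^ Suc n \<le> 1/2" for n
    by (simp add: power_le_one)
  have inv: "1 \<le> 1 / (1 - h)" if "0 \<le> h" "h \<le> 1/2" for h :: real
    using that by (simp add: field_simps)
  have g: "1 \<le> g" unfolding g_def by (rule inv[OF _ half]) simp
  have g_mult: "g * (1 - (1/2) ^ Suc e) = 1" using half[of e] by (simp add: g_def)
  have nonneg: "0 \<le> val \<sigma>" for \<sigma>
  proof -
    have "0 \<le> (if c then 1 - (1/2) ^ Suc n else 1 :: real)" for c n using half[of n] by auto
    then show ?thesis
      unfolding val_def case_prod_unfold using g by (simp only: if_splits) (simp del: power_Suc)
  qed
  have stuck: "val (\<sigma> @ [x]) = (if score e \<sigma> = 0 \<or> j = e then 0 else g ^ score e \<sigma>)"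
    if "run (\<sigma> @ [x]) = (Suc l, p, q, j, True)" "q \<le> l" for \<sigma> x l p q j
    using that by (simp add: val_def score_snoc)
  \<comment> \<open>Opening an eligible block raises the score, but
    \<open>g * (1 - (1/2) ^ Suc e) = 1\<close> cancels the gain until the choice is made.\<close>
  have block: "val (\<sigma> @ [x]) = (if score e \<sigma> = 0 then 0 else g ^ score e \<sigma>)"
    if "run (\<sigma> @ [x]) = (Suc l, q, Suc l, 0, False)" for \<sigma> x l q
    using that g_mult by (simp add: val_def score_snoc mult_ac)
  have choose: "val (\<sigma> @ [x]) = (if score e \<sigma> = 0 then 0 else g ^ score e \<sigma> *
      (if clock e p < clock e q \<and> j \<le> e then 1 - (1/2) ^ Suc (e - j) else 1))"
    if "run (\<sigma> @ [x]) = (Suc l, p, q, j, False)" "q \<le> l" for \<sigma> x l p q j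
    using that by (simp add: val_def score_snoc)
  have "measure slow_measure (\<Union>\<sigma>\<in>{\<sigma>. k \<le> score e \<sigma>}. cylinder \<sigma>) * (g ^ k / 2) \<le> val []"
  proof (rule slow_measure_ville)
    fix \<sigma>
    obtain l p q j w where st: "run \<sigma> = (l, p, q, j, w)" by (cases "run \<sigma>")
    have ql: "q \<le> l" using run_invariant[OF st] by simp
    define a where "a = (if score e \<sigma> = 0 then 0 else g ^ score e \<sigma>)"
    have a: "0 \<le> a" using g by (simp add: a_def)
    have val: "val \<sigma> = a * (if \<not> w \<and> clock e p < clock e q \<and> j \<le> e then 1 - (1/2) ^ Suc (e - j) else 1)"
      by (simp add: val_def st a_def)
    show "0 \<le> val \<sigma>" by (rule nonneg)
    show "val (\<sigma> @ [False]) \<le> val \<sigma>" if "waiting \<sigma>"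
    proof -
      have w: "w" using that waiting_iff[OF st] by simp
      have "run (\<sigma> @ [False]) = (Suc l, p, q, j, True) \<or> run (\<sigma> @ [False]) = (Suc l, q, Suc l, 0, False)"
        using w by (simp add: run_snoc st step_simp)
      then have "val (\<sigma> @ [False]) \<le> a"
        using stuck[OF _ ql, of \<sigma> False p j] block[of \<sigma> False l q] a by (auto simp: a_def)
      then show ?thesis using w by (simp add: val)
    qed
    show "val (\<sigma> @ [False]) + val (\<sigma> @ [True]) \<le> 2 * val \<sigma>" if "\<not> waiting \<sigma>"
    proof -
      have w: "\<not> w" using that waiting_iff[OF st] by simp
      have "run (\<sigma> @ [True]) = (Suc l, p, q, Suc j, False)"
        using w by (simp add: run_snoc st step_simp)
      then have T: "val (\<sigma> @ [True]) =
          a * (if clock e p < clock e q \<and> Suc j \<le> e then 1 - (1/2) ^ Suc (e - Suc j) else 1)"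
        using choose[OF _ ql, of \<sigma> True p "Suc j"] by (simp add: a_def)
      have "run (\<sigma> @ [False]) = (if clock j p < clock j q then (Suc l, p, q, j, True) else (Suc l, q, Suc l, 0, False))"
        using w by (simp add: run_snoc st step_simp)
      then have F: "val (\<sigma> @ [False]) = (if clock j p < clock j q \<and> j = e then 0 else a)"
        using stuck[OF _ ql, of \<sigma> False p j] block[of \<sigma> False l q] by (auto simp: a_def split: if_splits)
      consider "clock e p < clock e q" "j < e" | "clock e p < clock e q" "j = e" | "clock e p < clock e q" "e < j"
        | "\<not> clock e p < clock e q" by linarith
      then show ?thesis
      proof cases
        case 1
        then have "Suc (e - j) = Suc (Suc (e - Suc j))" by simp
        then show ?thesis unfolding T F val using w 1 a by (simp add: algebra_simps)
      qed (use a w in \<open>auto simp: T F val\<close>)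
    qed
  next
    fix \<sigma> assume "\<sigma> \<in> {\<sigma>. k \<le> score e \<sigma>}"
    then have k: "k \<le> score e \<sigma>" by simp
    obtain l p q j w where st: "run \<sigma> = (l, p, q, j, w)" by (cases "run \<sigma>")
    have "g ^ k * (1/2) \<le> g ^ score e \<sigma> *
        (if \<not> w \<and> clock e p < clock e q \<and> j \<le> e then 1 - (1/2) ^ Suc (e - j) else 1)"
      using g half[of "e - j"] k by (intro mult_mono power_increasing) auto
    then show "g ^ k / 2 \<le> val \<sigma>" using k \<open>0 < k\<close> by (simp add: val_def st)
  qed (use g in auto)
  also have "val [] = g" by (simp add: val_def)
  finally show ?thesis .
qed

lemma score_test:
  obtains N where "MartinLof_test slow_measure (\<lambda>i. \<Union>\<sigma>\<in>{\<sigma>. N * (i + 2) \<le> score e \<sigma>}. cylinder \<sigma>)"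
proof -
  define g :: real where "g = 1 / (1 - (1/2) ^ Suc e)"
  have "1 < 1 / (1 - h) \<and> 1 / (1 - h) \<le> 2" if "0 < h" "h \<le> 1/2" for h :: real
    using that by (simp add: field_simps)
  moreover have "0 < (1/2 :: real) ^ Suc e" "(1/2 :: real) ^ Suc e \<le> 1/2"
    by (simp_all add: power_le_one)
  ultimately have g: "1 < g" "g \<le> 2" unfolding g_def by blast+
  \<comment> \<open>Score \<open>N * (i + 2)\<close> then means capital at least 2^(i+2) / 2,
    against an initial capital of at most 2; the quotient is 2^-i.\<close>
  obtain N where N: "2 < g ^ N" using real_arch_pow[OF g(1)] by blast
  have "N \<noteq> 0" using N by (intro notI) simp
  have le: "measure slow_measure (\<Union>\<sigma>\<in>{\<sigma>. N * (i + 2) \<le> score e \<sigma>}. cylinder \<sigma>) \<le> (1/2) ^ i" (is "?m \<le> _") for i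
  proof -
    have "?m * (g ^ (N * (i + 2)) / 2) \<le> g"
      unfolding g_def using \<open>N \<noteq> 0\<close> by (intro score_measure_bound) simp
    moreover have "(2::real) ^ (i + 2) \<le> g ^ (N * (i + 2))"
      unfolding power_mult using N by (intro power_mono) auto
    then have "?m * (2 ^ (i + 2) / 2) \<le> ?m * (g ^ (N * (i + 2)) / 2)"
      by (intro mult_left_mono) auto
    ultimately have "?m * (2 ^ (i + 2) / 2) \<le> 2" using g(2) by linarith
    then show ?thesis by (simp add: field_simps power_divide)
  qed
  have "uniformly_Sigma01 (\<lambda>i. \<Union>\<sigma>\<in>{\<sigma>. \<exists>s::nat. N * (i + 2) \<le> score e \<sigma>}. cylinder \<sigma>)"
    by (rule uniformly_Sigma01I) (intro recursive_intros recursive_comp[OF recursive_score])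
  then have "MartinLof_test slow_measure (\<lambda>i. \<Union>\<sigma>\<in>{\<sigma>. N * (i + 2) \<le> score e \<sigma>}. cylinder \<sigma>)"
    using le by (simp add: MartinLof_test_def)
  then show ?thesis by (rule that)
qed

text \<open>The indicator of massless strings is a supermartingale with initial value 0. Avoiding
  this test forces a sequence to show only zeros while waiting.\<close>

lemma null_test: "MartinLof_test slow_measure (\<lambda>i. \<Union>\<sigma>\<in>{\<sigma>. scaled_mass \<sigma> = 0}. cylinder \<sigma>)"
proof -
  have "measure slow_measure (\<Union>\<sigma>\<in>{\<sigma>. scaled_mass \<sigma> = 0}. cylinder \<sigma>) * 1
      \<le> of_bool (scaled_mass [] = 0)"
    by (rule slow_measure_ville) (auto simp: scaled_mass_snoc)
  then have "measure slow_measure (\<Union>\<sigma>\<in>{\<sigma>. scaled_mass \<sigma> = 0}. cylinder \<sigma>) \<le> (1/2) ^ i" for i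
    by (simp add: order_trans[of _ 0])
  moreover have "uniformly_Sigma01 (\<lambda>i. \<Union>\<sigma>\<in>{\<sigma>. \<exists>s::nat. scaled_mass \<sigma> = 0}. cylinder \<sigma>)"
    by (rule uniformly_Sigma01I) (intro recursive_intros recursive_comp[OF recursive_scaled_mass])
  ultimately show ?thesis by (simp add: MartinLof_test_def)
qed

text \<open>Excludes a sequence that reads ones forever and so never completes its choice of an
  index. Each bit from \<open>n0\<close> on halves the mass, and the finite prefix is built into the
  enumeration.\<close>

lemma ones_test:
  assumes "\<And>n. n0 \<le> n \<Longrightarrow> X n \<and> \<not> waiting (take_seq n X)"
  obtains V where "MartinLof_test slow_measure V" "\<And>i. X \<in> V i"
proof -
  define V where "V = (\<lambda>i. \<Union>\<sigma>\<in>{\<sigma>. \<exists>s::nat. \<sigma> = take_seq n0 X @ replicate i True}. cylinder \<sigma>)"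
  have eq: "take_seq (n0 + i) X = take_seq n0 X @ replicate i True" for i
    using assms by (induction i) (simp_all add: take_seq_Suc replicate_append_same[symmetric])
  have "measure slow_measure (cylinder (take_seq (n0 + i) X)) \<le> (1/2) ^ i" for i
  proof (induction i)
    case 0
    show ?case
      using prob_space.prob_le_1[OF cantor_measure_prob[OF cantor_measure_slow]] by simp
  next
    case (Suc i)
    then show ?case using assms[of "n0 + i"] by (simp add: take_seq_Suc measure_slow_snoc)
  qed
  moreover have "V i = cylinder (take_seq (n0 + i) X)" for i by (simp add: V_def eq)
  moreover have "uniformly_Sigma01 V"
    unfolding V_def by (rule uniformly_Sigma01I) (intro recursive_intros)
  ultimately show ?thesis
    by (intro that[of V]) (simp_all add: MartinLof_test_def mem_cylinder_iff)
qed

text \<open>Between the lengths \<open>f n\<close> and \<open>f (Suc n)\<close> a computably perfect class must branch, which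
  is impossible while waiting.\<close>

lemma no_perfect_while_waiting:
  assumes perfect: "\<And>n \<sigma>. \<sigma> \<in> Ext D \<Longrightarrow> length \<sigma> = f n \<Longrightarrow>
      \<exists>\<tau>1\<in>Ext D. \<exists>\<tau>2\<in>Ext D. \<tau>1 \<parallel> \<tau>2 \<and> prefix \<sigma> \<tau>1 \<and> prefix \<sigma> \<tau>2 \<and>
        length \<tau>1 = f (Suc n) \<and> length \<tau>2 = f (Suc n)"
    and f: "strict_mono f"
    and mass: "\<And>X n. X \<in> D \<Longrightarrow> scaled_mass (take_seq n X) \<noteq> 0"
    and X: "X \<in> D"
    and waiting: "\<And>m. f n \<le> m \<Longrightarrow> m < f (Suc n) \<Longrightarrow> waiting (take_seq m X)"
  shows False
proof -
  have Ext_iff: "\<sigma> \<in> Ext D \<longleftrightarrow> (\<exists>Y\<in>D. take_seq (length \<sigma>) Y = \<sigma>)" for \<sigma>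
    using mem_cylinder_iff by (auto simp: Ext_def cylinder_def)
  have unique: "\<tau> = take_seq (f (Suc n)) X"
    if \<tau>: "\<tau> \<in> Ext D" "prefix (take_seq (f n) X) \<tau>" "length \<tau> = f (Suc n)" for \<tau>
  proof -
    obtain Y where Y: "Y \<in> D" "take_seq (f (Suc n)) Y = \<tau>" using \<tau> Ext_iff by auto
    have le: "f n \<le> f (Suc n)" using strict_monoD[OF f, of n "Suc n"] by simp
    have "take_seq (f n) Y = take_seq (f n) X"
      using \<tau>(2) take_take_seq[OF le, of Y] Y(2) by (metis append_eq_conv_conj length_take_seq prefixE)
    have "m \<le> f (Suc n) \<longrightarrow> take_seq m Y = take_seq m X" if "f n \<le> m" for m
      using that
    proof (induction m rule: dec_induct)
      case (step m)
      have "take_seq (Suc m) Y = take_seq (Suc m) X" if "Suc m \<le> f (Suc n)"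
      proof -
        have eq: "take_seq m Y = take_seq m X" and w: "waiting (take_seq m X)"
          using that step.IH waiting[of m] step.hyps by simp_all
        \<comment> \<open>A one read while waiting would make the mass of the prefix zero.\<close>
        have "\<not> Y m" "\<not> X m"
          using mass[OF Y(1), of "Suc m"] mass[OF X, of "Suc m"] w eq
          by (auto simp: take_seq_Suc scaled_mass_snoc split: if_splits)
        then show ?thesis using eq by (simp add: take_seq_Suc)
      qed
      then show ?case by blast
    qed (use \<open>take_seq (f n) Y = take_seq (f n) X\<close> in simp)
    then show ?thesis using le Y(2) by blast
  qed
  have "take_seq (f n) X \<in> Ext D" using X by (auto simp: Ext_iff)
  then obtain \<tau>1 \<tau>2 where "\<tau>1 \<in> Ext D" "\<tau>2 \<in> Ext D" "\<tau>1 \<parallel> \<tau>2"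
    "prefix (take_seq (f n) X) \<tau>1" "prefix (take_seq (f n) X) \<tau>2"
    "length \<tau>1 = f (Suc n)" "length \<tau>2 = f (Suc n)"
    using perfect[of "take_seq (f n) X" n] by auto
  then show False using unique by (metis parallelE prefix_order.refl)
qed

lemma run_Suc:
  assumes "run (take_seq m X) = (l, p, q, j, w)"
  shows "(\<exists>j' w'. run (take_seq (Suc m) X) = (Suc m, p, q, j', w')) \<or>
    run (take_seq (Suc m) X) = (Suc m, q, Suc m, 0, False)"
  using assms run_invariant[OF assms] by (auto simp: take_seq_Suc run_snoc step_simp)

text \<open>A zero outside a wait starts a wait or a new block. If no block started after
  \<open>n\<close>, the zero or wait supplied by \<open>zeros\<close> would lead into a wait without
  end, against \<open>free\<close>.\<close>

lemma infinitely_many_blocks: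
  assumes free: "\<And>n. \<exists>m\<ge>n. \<not> waiting (take_seq m X)"
    and zeros: "\<And>n. \<exists>m\<ge>n. waiting (take_seq m X) \<or> \<not> X m"
  shows "\<exists>m\<ge>n. \<exists>p. run (take_seq m X) = (m, p, m, 0, False)"
proof (rule ccontr)
  assume "\<not> ?thesis"
  then have no_block: "run (take_seq m X) \<noteq> (m, p, m, 0, False)" if "n \<le> m" for m p
    using that by blast
  have wait_step: "waiting (take_seq (Suc m) X)" if "n \<le> m" "waiting (take_seq m X) \<or> \<not> X m" for m
  proof -
    obtain l p q j w where st: "run (take_seq m X) = (l, p, q, j, w)" by (cases "run (take_seq m X)")
    have "l = m" using run_invariant[OF st] by simp
    then have "run (take_seq (Suc m) X) = step (m, p, q, j, w) (X m)" using st by (simp add: take_seq_Suc run_snoc)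
    then show ?thesis
      using that no_block[of "Suc m" q] waiting_iff[OF st]
      by (auto simp: waiting_def step_simp split: if_splits)
  qed
  obtain m where m: "n \<le> m" "waiting (take_seq m X) \<or> \<not> X m" using zeros by blast
  have "waiting (take_seq k X)" if "Suc m \<le> k" for k
    using that
  proof (induction k rule: dec_induct)
    case base
    show ?case using wait_step m by blast
  next
    case (step k)
    then show ?case using wait_step[of k] m(1) by simp
  qed
  then show False using free by blast
qed

text \<open>The intervals from \<open>p\<close> to \<open>q\<close> of consecutive blocks are
  adjacent, so advances of the clock do not escape notice. A score constant from some point on would
  freeze the clock at all later block starts.\<close>

lemma score_unbounded:
  assumes blocks: "\<And>n. \<exists>m\<ge>n. \<exists>p. run (take_seq m X) = (m, p, m, 0, False)"
    and unbounded: "\<And>k. \<exists>s. k \<le> clock e s"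
    and no_wait: "\<And>n p q. run (take_seq n X) \<noteq> (n, p, q, e, True)"
  shows "\<exists>n. k \<le> score e (take_seq n X)"
proof -
  have score_Suc: "score e (take_seq m X) \<noteq> 0 \<Longrightarrow> score e (take_seq (Suc m) X) =
      (case run (take_seq (Suc m) X) of (l, p, q, j, w) \<Rightarrow>
        if q = l \<and> clock e p < clock e q then Suc (score e (take_seq m X)) else score e (take_seq m X))" for m
  proof -
    obtain l p q j w where st: "run (take_seq (Suc m) X) = (l, p, q, j, w)"
      by (cases "run (take_seq (Suc m) X)")
    have "\<not> (w \<and> j = e)" using no_wait[of "Suc m" p q] run_invariant[OF st] st by auto
    then show "score e (take_seq m X) \<noteq> 0 \<Longrightarrow> ?thesis"
      using st unfolding take_seq_Suc score_snoc by auto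
  qed
  have nonzero: "score e (take_seq m X) \<noteq> 0" for m
  proof (induction m)
    case (Suc m)
    then show ?case using score_Suc[OF Suc] by (auto split: prod.splits)
  qed simp
  have "score e (take_seq m X) \<le> score e (take_seq (Suc m) X)" for m
    using score_Suc[OF nonzero[of m]] by (auto split: prod.splits)
  then have mono: "score e (take_seq m X) \<le> score e (take_seq n X)" if "m \<le> n" for m n
    using lift_Suc_mono_le[of "\<lambda>n. score e (take_seq n X)"] that by blast
  show ?thesis
  proof (induction k)
    case (Suc k)
    then obtain n where n: "k \<le> score e (take_seq n X)" by blast
    show ?case
    proof (rule ccontr)
      assume "\<not> ?thesis"
      then have const: "score e (take_seq m X) = k" if "n \<le> m" for m
        using mono[OF that] n by (metis not_less_eq_eq le_antisym le_trans)
      obtain l0 p0 q0 j0 w0 where st0: "run (take_seq n X) = (l0, p0, q0, j0, w0)"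
        by (cases "run (take_seq n X)")
      have same: "\<exists>p q j w. run (take_seq m X) = (m, p, q, j, w) \<and> clock e q = clock e q0" if "n \<le> m" for m
        using that
      proof (induction m rule: dec_induct)
        case base
        show ?case using st0 run_invariant[OF st0] by simp
      next
        case (step m)
        then obtain p q j w where st: "run (take_seq m X) = (m, p, q, j, w)" "clock e q = clock e q0"
          by blast
        from run_Suc[OF st(1)] show ?case
        proof
          assume new: "run (take_seq (Suc m) X) = (Suc m, q, Suc m, 0, False)"
          have "\<not> clock e q < clock e (Suc m)"
            using score_Suc[OF nonzero[of m]] const[of m] const[of "Suc m"] step.hyps new by auto
          moreover have "clock e q \<le> clock e (Suc m)"
            using run_invariant[OF st(1)] by (intro clock_mono) simp
          ultimately show ?case using new st(2) by auto
        qed (use st(2) in auto)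
      qed
      obtain s where s: "Suc (clock e q0) \<le> clock e s" using unbounded by blast
      obtain m p where m: "max n s \<le> m" "run (take_seq m X) = (m, p, m, 0, False)"
        using blocks by blast
      have "clock e m = clock e q0" using same[of m] m by auto
      moreover have "clock e s \<le> clock e m" using m(1) by (intro clock_mono) simp
      ultimately show False using s by simp
    qed
  qed simp
qed

text \<open>\<open>S\<close> stands for one component of a universal test. One member
  \<open>X\<close> of a perfect class leads to the contradiction: branching forbids \<open>X\<close>
  to wait forever or for the clock of the function \<open>f\<close> that witnesses perfection, and
  then \<open>X\<close> fails the score test.\<close>

lemma diminutive_class_avoiding_tests:
  assumes absorbing: "\<And>V. MartinLof_test slow_measure V \<Longrightarrow> \<exists>j. V j \<subseteq> S"
  shows "diminutive_class (- S)"
  unfolding diminutive_class_def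
proof
  assume "\<exists>D\<subseteq>- S. computably_perfect D"
  then obtain D f where D: "D \<subseteq> - S" "D \<noteq> {}" and f: "computable f" "strict_mono f"
    and perfect: "\<And>n \<sigma>. \<sigma> \<in> Ext D \<Longrightarrow> length \<sigma> = f n \<Longrightarrow>
      \<exists>\<tau>1\<in>Ext D. \<exists>\<tau>2\<in>Ext D. \<tau>1 \<parallel> \<tau>2 \<and> prefix \<sigma> \<tau>1 \<and> prefix \<sigma> \<tau>2 \<and>
        length \<tau>1 = f (Suc n) \<and> length \<tau>2 = f (Suc n)"
    unfolding computably_perfect_def by blast
  have mass: "scaled_mass (take_seq n Y) \<noteq> 0" if "Y \<in> D" for Y n
  proof
    assume "scaled_mass (take_seq n Y) = 0"
    then have "Y \<in> (\<Union>\<sigma>\<in>{\<sigma>. scaled_mass \<sigma> = 0}. cylinder \<sigma>)"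
      by (intro UN_I[of "take_seq n Y"]) (simp_all add: mem_cylinder_iff)
    then show False using absorbing[OF null_test] that D(1) by blast
  qed
  obtain X where X: "X \<in> D" using D(2) by blast
  have not_in: "\<exists>j. X \<notin> V j" if "MartinLof_test slow_measure V" for V
    using absorbing[OF that] X D(1) by blast
  have contradiction: False if "\<And>m. f n \<le> m \<Longrightarrow> m < f (Suc n) \<Longrightarrow> waiting (take_seq m X)" for n
    by (rule no_perfect_while_waiting[where D = D and f = f and n = n and X = X],
        rule perfect, assumption, assumption, rule f(2), rule mass, assumption, rule X, rule that)

  have free: "\<exists>m\<ge>n. \<not> waiting (take_seq m X)" for n
  proof (rule ccontr)
    assume "\<not> ?thesis"
    \<comment> \<open>Waiting from \<open>n\<close> on therefore covers all lengths between
      \<open>f n\<close> and \<open>f (Suc n)\<close>.\<close>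
    moreover have "n \<le> f n" by (rule strict_mono_imp_increasing[OF f(2)])
    ultimately show False by (intro contradiction[of n]) auto
  qed
  have zeros: "\<exists>m\<ge>n. waiting (take_seq m X) \<or> \<not> X m" for n
  proof (rule ccontr)
    assume "\<not> ?thesis"
    then have "\<And>m. n \<le> m \<Longrightarrow> X m \<and> \<not> waiting (take_seq m X)" by blast
    then obtain V where "MartinLof_test slow_measure V" "\<And>i. X \<in> V i"
      by (elim ones_test) (rule that)
    then show False using not_in by blast
  qed
  note blocks = infinitely_many_blocks[OF free zeros]
  obtain e where unbounded: "\<And>k. \<exists>s. k \<le> clock e s"
    and gap: "\<And>m s. clock e m + 2 \<le> clock e s \<Longrightarrow> \<exists>n. m + e + 1 \<le> f n \<and> f (Suc n) \<le> s"
    using clock_for_function[OF f] by blast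
  have no_wait: "run (take_seq n X) \<noteq> (n, p, q, e, True)" for n p q
  proof
    assume st: "run (take_seq n X) = (n, p, q, e, True)"
    \<comment> \<open>The length at which the wait is released. Before it only the length component
      of the state changes, and \<open>gap\<close> puts an interval from \<open>f k\<close> to
      \<open>f (Suc k)\<close> inside the wait.\<close>
    define s where "s = (LEAST s. clock e q + 2 \<le> clock e s)"
    have s: "clock e q + 2 \<le> clock e s" unfolding s_def using unbounded by (rule LeastI_ex)
    obtain k where k: "q + e + 1 \<le> f k" "f (Suc k) \<le> s" using gap[OF s] by blast
    \<comment> \<open>\<open>n\<close> may lie in the middle of the wait, so the invariant is used
      to go back to its beginning.\<close>
    have "run (take (q + e + 1) (take_seq n X)) = (q + e + 1, p, q, e, True)" "q + e + 1 \<le> n"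
      using run_invariant[OF st] by simp_all
    then have start: "run (take_seq (q + e + 1) X) = (q + e + 1, p, q, e, True)"
      using take_take_seq[of "q + e + 1" n X] by simp
    have "m < s \<longrightarrow> run (take_seq m X) = (m, p, q, e, True)" if "q + e + 1 \<le> m" for m
      using that
    proof (induction m rule: dec_induct)
      case (step m)
      have "\<not> clock e q + 2 \<le> clock e (Suc m)" if "Suc m < s"
        using not_less_Least[OF that[unfolded s_def]] .
      then show ?case using step.IH by (auto simp: take_seq_Suc run_snoc step_simp)
    qed (use start in simp)
    then have "waiting (take_seq m X)" if "f k \<le> m" "m < f (Suc k)" for m
      using that k by (simp add: waiting_def)
    from contradiction[OF this] show False .
  qed
  obtain N where N: "MartinLof_test slow_measure (\<lambda>i. \<Union>\<sigma>\<in>{\<sigma>. N * (i + 2) \<le> score e \<sigma>}. cylinder \<sigma>)"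
    by (rule score_test)
  have "X \<in> (\<Union>\<sigma>\<in>{\<sigma>. N * (i + 2) \<le> score e \<sigma>}. cylinder \<sigma>)" for i
  proof -
    obtain n where "N * (i + 2) \<le> score e (take_seq n X)"
      using score_unbounded[OF blocks unbounded no_wait] by blast
    then show ?thesis by (intro UN_I[of "take_seq n X"]) (simp_all add: mem_cylinder_iff)
  qed
  then show False using not_in[OF N] by blast
qed

theorem theorem6p9:
  shows "\<exists>\<mu> :: cantor measure. computable_measure \<mu> \<and> diminutive_measure \<mu> \<and> \<not> trivial_measure \<mu>"
proof (intro exI conjI)
  obtain U where U: "MartinLof_test slow_measure U"
    "\<And>V i. MartinLof_test slow_measure V \<Longrightarrow> \<exists>j. V j \<subseteq> U i"
    using universal_test_exists[OF cantor_measure_slow recursive_scaled_mass measure_slow_cylinder]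
    by blast
  have "universal_MartinLof_test slow_measure U"
    unfolding universal_MartinLof_test_def using U by blast
  moreover have "diminutive_class (- U i)" for i
    by (rule diminutive_class_avoiding_tests) (rule U(2))
  ultimately show "diminutive_measure slow_measure"
    unfolding diminutive_measure_def using computable_measure_slow by blast
qed (rule computable_measure_slow not_trivial_slow)+

end
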